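(* Let $H\in C^0(\mathbb{R}^2)\cap L^2(\mathbb{R}^2)$ be a real-valued function. If $N_H<1$, then no $H$-loop exists.
   Context: Points of $\mathbb{R}^2$ are written in complex notation; $iz=(-y,x)$ for $z=(x,y)$. Functions on the unit circle $\mathbb{S}^1$ are identified with $2\pi$-periodic functions of $\theta$, and $'$ denotes the derivative in $\theta$. An $H$-loop is a non-constant function $u\in C^2(\mathbb{S}^1,\mathbb{R}^2)$ solving $u''=|u'|\,H(u)\,iu'$ on $\mathbb{S}^1$. For $H\in L^1_{\rm loc}(\mathbb{R}^2)$, the distribution $\mathrm{dl}H$ (which represents $\nabla H(z)\cdot z$) is defined by $\langle \mathrm{dl}H,\varphi\rangle=-\int_{\mathbb{R}^2}H(z)\,\mathrm{div}(\varphi(z)z)\,dz$ for $\varphi\in C^\infty_c(\mathbb{R}^2)$. One says $\mathrm{dl}H\in L^2(\mathbb{R}^2)$ if this distribution extends continuously to $L^2(\mathbb{R}^2)$ (so that it is represented by an $L^2$ function). In that case $N_H:=\frac{1}{\sqrt{4\pi}}\big(\int_{\mathbb{R}^2}|\mathrm{dl}H(z)|^2\,dz\big)^{1/2}$; otherwise $N_H=\infty$. *)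

theory Defs
  imports "HOL-Analysis.Analysis"
begin

text \<open>The plane is the type \<^typ>\<open>complex\<close>, with its Euclidean structure and the
  measure \<^term>\<open>lborel :: complex measure\<close>. A function on the unit circle is a
  \<open>2 * pi\<close>-periodic function on the real line.\<close>

definition C2_circle :: "(real \<Rightarrow> complex) \<Rightarrow> bool" where
  "C2_circle u \<longleftrightarrow>
     (\<forall>t. u (t + 2 * pi) = u t) \<and>
     (\<forall>t. u differentiable (at t)) \<and>
     (\<forall>t. (\<lambda>s. vector_derivative u (at s)) differentiable (at t)) \<and>
     continuous_on UNIV
       (\<lambda>t. vector_derivative (\<lambda>s. vector_derivative u (at s)) (at t))"

definition H_loop :: "(complex \<Rightarrow> real) \<Rightarrow> (real \<Rightarrow> complex) \<Rightarrow> bool" where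
  "H_loop H u \<longleftrightarrow>
     C2_circle u \<and> \<not> u constant_on UNIV \<and>
     (\<forall>t. vector_derivative (\<lambda>s. vector_derivative u (at s)) (at t) =
          (norm (vector_derivative u (at t)) * H (u t)) *\<^sub>R (\<i> * vector_derivative u (at t)))"

fun C_k :: "nat \<Rightarrow> (complex \<Rightarrow> real) \<Rightarrow> bool" where
  "C_k 0 f \<longleftrightarrow> continuous_on UNIV f"
| "C_k (Suc k) f \<longleftrightarrow>
     (\<forall>z. f differentiable (at z)) \<and> (\<forall>v. C_k k (\<lambda>z. frechet_derivative f (at z) v))"

definition test_function :: "(complex \<Rightarrow> real) \<Rightarrow> bool" where
  "test_function \<phi> \<longleftrightarrow> (\<forall>k. C_k k \<phi>) \<and> compact (closure {z. \<phi> z \<noteq> 0})"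

definition divergence :: "(complex \<Rightarrow> complex) \<Rightarrow> complex \<Rightarrow> real" where
  "divergence X z = (\<Sum>b\<in>Basis. frechet_derivative X (at z) b \<bullet> b)"

definition dl :: "(complex \<Rightarrow> real) \<Rightarrow> (complex \<Rightarrow> real) \<Rightarrow> real" where
  "dl H \<phi> = - (LINT z|lborel. H z * divergence (\<lambda>w. \<phi> w *\<^sub>R w) z)"

definition square_integrable :: "(complex \<Rightarrow> real) \<Rightarrow> bool" where
  "square_integrable f \<longleftrightarrow>
     f \<in> borel_measurable lborel \<and> integrable lborel (\<lambda>z. (f z)\<^sup>2)"

definition L2_norm :: "(complex \<Rightarrow> real) \<Rightarrow> real" where
  "L2_norm f = sqrt (LINT z|lborel. (f z)\<^sup>2)"

text \<open>Functionals on \<open>L\<^sup>2\<close> are rendered as functionals on square integrable functions.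
  The norm bound forces equal values on functions that agree almost everywhere.\<close>

definition continuous_L2_functional :: "((complex \<Rightarrow> real) \<Rightarrow> real) \<Rightarrow> bool" where
  "continuous_L2_functional T \<longleftrightarrow>
     (\<forall>f g. square_integrable f \<longrightarrow> square_integrable g \<longrightarrow>
        T (\<lambda>z. f z + g z) = T f + T g) \<and>
     (\<forall>c f. square_integrable f \<longrightarrow> T (\<lambda>z. c * f z) = c * T f) \<and>
     (\<exists>C. \<forall>f. square_integrable f \<longrightarrow> \<bar>T f\<bar> \<le> C * L2_norm f)"

definition dl_in_L2 :: "(complex \<Rightarrow> real) \<Rightarrow> bool" where
  "dl_in_L2 H \<longleftrightarrow>
     (\<exists>T. continuous_L2_functional T \<and> (\<forall>\<phi>. test_function \<phi> \<longrightarrow> T \<phi> = dl H \<phi>))"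

text \<open>If \<^term>\<open>dl_in_L2 H\<close>, a representing function exists by the Riesz representation
  theorem and is unique up to null sets, so the choice does not affect its norm.\<close>

definition dl_fun :: "(complex \<Rightarrow> real) \<Rightarrow> complex \<Rightarrow> real" where
  "dl_fun H = (SOME g. square_integrable g \<and>
     (\<forall>\<phi>. test_function \<phi> \<longrightarrow> dl H \<phi> = (LINT z|lborel. g z * \<phi> z)))"

definition N_H :: "(complex \<Rightarrow> real) \<Rightarrow> ereal" where
  "N_H H = (if dl_in_L2 H then ereal (1 / sqrt (4 * pi) * L2_norm (dl_fun H)) else \<infinity>)"

end

theory Submission imports Defs "HOL-Probability.Distributions" begin

text \<open>
  An \<open>H\<close>-loop \<open>u\<close> has constant speed \<open>c\<close>, and integrating \<open>(u \<bullet> u')'\<close> over a period shows that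
  \<open>\<integral> H(u) (u \<times> u') = 2 \<pi> c\<close>. Up to sign, the left-hand side is the integral of \<open>H\<close> against
  \<open>z \<bullet> \<nabla>\<omega>\<close>, where \<open>\<omega>\<close> is the winding number of \<open>u\<close>, hence also that of \<open>(dl H + 2 H) \<omega>\<close>. Since
  \<open>dl + 1\<close> is skew on \<open>L\<^sup>2\<close> (it generates the unitary dilations), \<open>dl H + 2 H\<close> has the same \<open>L\<^sup>2\<close> norm
  as \<open>dl H\<close>. By the Banchoff-Pohl inequality \<open>\<parallel>\<omega>\<parallel> \<le> \<surd>\<pi> c\<close>, so that \<open>2 \<surd>\<pi> \<le> \<parallel>dl H\<parallel>\<close>, that is, \<open>N_H \<ge> 1\<close>.

  The number \<open>\<omega>\<close> is regularised by superposing Gaussian kernels, for which the double curve integral giving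
  \<open>\<parallel>\<omega>\<parallel>\<^sup>2\<close> is explicit; up to a total derivative along the curve, its integrand is the product of
  one tangent with the reflection of the other in the chord, which is at most \<open>c\<^sup>2\<close>. The skewness of
  \<open>dl + 1\<close> is used in the form of an exact identity between difference quotients along dilations,
  which avoids differentiating \<open>H\<close>.
\<close>

section \<open>The Riesz representation theorem in \<open>L\<^sup>2\<close>\<close>

lemma square_integrable_mult:
  assumes "square_integrable f" "square_integrable g"
  shows "integrable lborel (\<lambda>z. f z * g z)"
proof (rule Bochner_Integration.integrable_bound)
  show "integrable lborel (\<lambda>z. (f z)\<^sup>2 + (g z)\<^sup>2)"
    using assms by (simp add: square_integrable_def)
  show "(\<lambda>z. f z * g z) \<in> borel_measurable lborel"
    using assms by (auto simp: square_integrable_def)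
  have "\<bar>f z * g z\<bar> \<le> (f z)\<^sup>2 + (g z)\<^sup>2" for z
    using sum_squares_bound[of "\<bar>f z\<bar>" "\<bar>g z\<bar>"] abs_ge_zero[of "f z * g z"]
    unfolding abs_mult power2_abs by linarith
  then show "AE z in lborel. norm (f z * g z) \<le> norm ((f z)\<^sup>2 + (g z)\<^sup>2)"
    by simp
qed

lemma square_integrable_cmult:
  "square_integrable f \<Longrightarrow> square_integrable (\<lambda>z. c * f z)"
  by (auto simp: square_integrable_def power_mult_distrib)

lemma square_integrable_add:
  assumes "square_integrable f" "square_integrable g"
  shows "square_integrable (\<lambda>z. f z + g z)"
  using assms square_integrable_mult[OF assms]
  by (auto simp add: square_integrable_def power2_sum mult.assoc)

lemma square_integrable_diff:
  assumes "square_integrable f" "square_integrable g"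
  shows "square_integrable (\<lambda>z. f z - g z)"
  using square_integrable_add[OF assms(1) square_integrable_cmult[OF assms(2), of "-1"]] by simp

lemma L2_norm_nonneg [simp]: "0 \<le> L2_norm f"
  by (simp add: L2_norm_def)

lemma L2_norm_power2: "(L2_norm f)\<^sup>2 = (LINT z|lborel. (f z)\<^sup>2)"
  by (simp add: L2_norm_def)

lemma L2_norm_cmult: "L2_norm (\<lambda>z. c * f z) = \<bar>c\<bar> * L2_norm f"
  by (simp add: L2_norm_def power_mult_distrib real_sqrt_mult)

lemma L2_norm_add_power2:
  assumes "square_integrable f" "square_integrable g"
  shows "(L2_norm (\<lambda>z. f z + g z))\<^sup>2 =
    (L2_norm f)\<^sup>2 + 2 * (LINT z|lborel. f z * g z) + (L2_norm g)\<^sup>2"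
  using assms square_integrable_mult[OF assms]
  by (simp add: square_integrable_def L2_norm_power2 power2_sum mult.assoc)

lemma L2_norm_diff_power2:
  assumes "square_integrable f" "square_integrable g"
  shows "(L2_norm (\<lambda>z. f z - g z))\<^sup>2 =
    (L2_norm f)\<^sup>2 - 2 * (LINT z|lborel. f z * g z) + (L2_norm g)\<^sup>2"
  using L2_norm_add_power2[OF assms(1) square_integrable_cmult[OF assms(2), of "-1"]]
    L2_norm_cmult[of "-1" g] by simp

lemma L2_norm_add_cmult_power2:
  assumes "square_integrable f" "square_integrable g"
  shows "(L2_norm (\<lambda>z. f z + t * g z))\<^sup>2 =
    (L2_norm f)\<^sup>2 + 2 * t * (LINT z|lborel. f z * g z) + t\<^sup>2 * (L2_norm g)\<^sup>2"
proof -
  have "(LINT z|lborel. f z * (t * g z)) = (LINT z|lborel. t * (f z * g z))"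
    by (intro Bochner_Integration.integral_cong) auto
  then show ?thesis
    using L2_norm_add_power2[OF assms(1) square_integrable_cmult[OF assms(2), of t]]
    by (simp add: L2_norm_cmult power_mult_distrib)
qed

lemma Cauchy_Schwarz_L2:
  assumes f: "square_integrable f" and g: "square_integrable g"
  shows "\<bar>LINT z|lborel. f z * g z\<bar> \<le> L2_norm f * L2_norm g"
proof -
  let ?A = "(L2_norm f)\<^sup>2" and ?B = "LINT z|lborel. f z * g z" and ?C = "(L2_norm g)\<^sup>2"
  have q: "0 \<le> ?A + 2 * t * ?B + t\<^sup>2 * ?C" for t
  proof -
    have "?A + 2 * t * ?B + t\<^sup>2 * ?C = (L2_norm (\<lambda>z. f z + t * g z))\<^sup>2"
      using L2_norm_add_cmult_power2[OF f g] by simp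
    then show ?thesis by simp
  qed
  have "?B\<^sup>2 \<le> ?A * ?C"
  proof (cases "?C = 0")
    case True
    have "?B = 0"
    proof (rule ccontr)
      assume "?B \<noteq> 0"
      then show False
        using q[of "- (?A + 1) / (2 * ?B)"] True by (simp add: field_simps)
    qed
    then show ?thesis by simp
  next
    case False
    then have "0 < ?C" by simp
    have "?A + 2 * (- ?B / c) * ?B + (- ?B / c)\<^sup>2 * c = ?A - ?B\<^sup>2 / c" if "0 < c" for c
      using that by (simp add: field_simps power2_eq_square)
    from q[of "- ?B / ?C", unfolded this[OF \<open>0 < ?C\<close>]] have "0 \<le> ?A - ?B\<^sup>2 / ?C" .
    then show ?thesis using \<open>0 < ?C\<close> by (simp add: field_simps)
  qed
  then show ?thesis
    by (intro abs_le_square_iff[THEN iffD2, of _ "L2_norm f * L2_norm g", simplified abs_mult abs_of_nonneg L2_norm_nonneg])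
      (simp add: power_mult_distrib)
qed

lemma L2_norm_triangle:
  assumes f: "square_integrable f" and g: "square_integrable g"
  shows "L2_norm (\<lambda>z. f z + g z) \<le> L2_norm f + L2_norm g"
proof (rule power2_le_imp_le)
  show "(L2_norm (\<lambda>z. f z + g z))\<^sup>2 \<le> (L2_norm f + L2_norm g)\<^sup>2"
    using Cauchy_Schwarz_L2[OF f g] L2_norm_add_power2[OF f g] by (simp add: power2_sum)
qed simp

lemma L2_complete:
  assumes f: "\<And>n. square_integrable (f n)"
    and d: "\<And>n. L2_norm (\<lambda>z. f (Suc n) z - f n z) \<le> (1/2) ^ n"
  shows "\<exists>F. square_integrable F \<and> (\<lambda>n. L2_norm (\<lambda>z. f n z - F z)) \<longlonglongrightarrow> 0"
proof -
  have meas [measurable]: "f n \<in> borel_measurable lborel" for n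
    using f by (simp add: square_integrable_def)
  have nn: "(\<integral>\<^sup>+z. ennreal ((f n z - f m z)\<^sup>2) \<partial>lborel) = ennreal ((L2_norm (\<lambda>z. f n z - f m z))\<^sup>2)" for n m
    using square_integrable_diff[OF f f, of n m]
    by (subst nn_integral_eq_integral) (auto simp: square_integrable_def L2_norm_power2)
  have dist: "L2_norm (\<lambda>z. f (n + k) z - f n z) \<le> 2 * (1/2)^n - 2 * (1/2)^(n+k)" for n k
  proof (induction k)
    case 0 then show ?case by (simp add: L2_norm_def)
  next
    case (Suc k)
    have "L2_norm (\<lambda>z. f (n + Suc k) z - f n z)
       = L2_norm (\<lambda>z. (f (Suc (n + k)) z - f (n+k) z) + (f (n+k) z - f n z))" by simp
    also have "\<dots> \<le> L2_norm (\<lambda>z. f (Suc (n + k)) z - f (n+k) z) + L2_norm (\<lambda>z. f (n+k) z - f n z)"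
      by (intro L2_norm_triangle square_integrable_diff f)
    finally show ?case using d[of "n+k"] Suc by simp
  qed
  have dist2: "L2_norm (\<lambda>z. f m z - f n z) \<le> 2 * (1/2)^n" if "n \<le> m" for n m
  proof -
    have "(0::real) \<le> (1/2)^m" by simp
    then show ?thesis using dist[of n "m - n", unfolded le_add_diff_inverse[OF that]] by linarith
  qed
  have fin: "(\<integral>\<^sup>+z. (\<Sum>n. ennreal (2^n * (f (Suc n) z - f n z)\<^sup>2)) \<partial>lborel) < \<infinity>"
  proof -
    have "(\<integral>\<^sup>+z. (\<Sum>n. ennreal (2^n * (f (Suc n) z - f n z)\<^sup>2)) \<partial>lborel)
      = (\<Sum>n. (\<integral>\<^sup>+z. ennreal (2^n * (f (Suc n) z - f n z)\<^sup>2) \<partial>lborel))"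
      by (rule nn_integral_suminf) simp
    also have "\<dots> = (\<Sum>n. ennreal (2^n * (L2_norm (\<lambda>z. f (Suc n) z - f n z))\<^sup>2))"
      by (simp add: ennreal_mult nn_integral_cmult nn)
    also have "\<dots> \<le> (\<Sum>n. ennreal ((1/2)^n))"
    proof (intro suminf_le summableI ennreal_leI)
      fix n
      have "2^n * (L2_norm (\<lambda>z. f (Suc n) z - f n z))\<^sup>2 \<le> 2^n * ((1/2)^n)\<^sup>2"
        by (intro mult_left_mono power_mono d) auto
      also have "\<dots> = (1/2)^n"
        by (simp add: power2_eq_square power_divide)
      finally show "2^n * (L2_norm (\<lambda>z. f (Suc n) z - f n z))\<^sup>2 \<le> (1/2)^n" .
    qed
    also have "\<dots> = ennreal (\<Sum>n. (1/2)^n)"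
      by (rule suminf_ennreal2) (auto intro: summable_geometric)
    finally show ?thesis by (simp add: le_less_trans)
  qed
  have "AE z in lborel. (\<Sum>n. ennreal (2^n * (f (Suc n) z - f n z)\<^sup>2)) \<noteq> \<infinity>"
    using fin by (intro nn_integral_PInf_AE) auto
  then have conv: "AE z in lborel. convergent (\<lambda>n. f n z)"
  proof eventually_elim
    case (elim z)
    have s1: "summable (\<lambda>n. 2^n * (f (Suc n) z - f n z)\<^sup>2)"
      by (rule summable_suminf_not_top) (use elim in auto)
    have "summable (\<lambda>n. f (Suc n) z - f n z)"
    proof (rule summable_comparison_test')
      show "summable (\<lambda>n. (1/2)^n + 2^n * (f (Suc n) z - f n z)\<^sup>2)"
        by (intro summable_add s1 summable_geometric) simp
      fix n
      let ?D = "\<bar>f (Suc n) z - f n z\<bar>"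
      show "norm (f (Suc n) z - f n z) \<le> (1/2)^n + 2^n * (f (Suc n) z - f n z)\<^sup>2"
      proof (cases "?D \<le> (1/2)^n")
        case True then show ?thesis by (simp add: add_increasing2)
      next
        case False
        then have "1 \<le> 2^n * ?D" by (simp add: power_divide field_simps)
        then have "?D * 1 \<le> ?D * (2^n * ?D)" by (intro mult_left_mono) auto
        also have "\<dots> = 2^n * (f (Suc n) z - f n z)\<^sup>2" 
          by (simp add: power2_eq_square abs_mult_self_eq)
        finally show ?thesis by (simp add: add_increasing)
      qed
    qed
    then have "summable (\<lambda>n. f (Suc n) z - f n z)" .
    then have "convergent (\<lambda>n. \<Sum>i<n. f (Suc i) z - f i z)"
      by (simp add: summable_iff_convergent)
    moreover have "(\<Sum>i<n. f (Suc i) z - f i z) = f n z - f 0 z" for n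
      by (induction n) auto
    ultimately have "convergent (\<lambda>n. (f n z - f 0 z) + f 0 z)"
      by (intro convergent_add convergent_const) simp
    then show ?case by simp
  qed
  define F where "F = (\<lambda>z. lim (\<lambda>n. f n z))"
  have Fm [measurable]: "F \<in> borel_measurable lborel"
    unfolding F_def by (rule borel_measurable_lim_metric) simp
  have lim: "AE z in lborel. (\<lambda>n. f n z) \<longlonglongrightarrow> F z"
    using conv by eventually_elim (simp add: F_def convergent_LIMSEQ_iff)
  have bd: "(\<integral>\<^sup>+z. ennreal ((f n z - F z)\<^sup>2) \<partial>lborel) \<le> ennreal ((2 * (1/2)^n)\<^sup>2)" for n
  proof -
    have "(\<integral>\<^sup>+z. ennreal ((f n z - F z)\<^sup>2) \<partial>lborel)
       = (\<integral>\<^sup>+z. liminf (\<lambda>m. ennreal ((f m z - f n z)\<^sup>2)) \<partial>lborel)"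
    proof (rule nn_integral_cong_AE)
      show "AE z in lborel. ennreal ((f n z - F z)\<^sup>2) = liminf (\<lambda>m. ennreal ((f m z - f n z)\<^sup>2))"
        using lim
      proof eventually_elim
        case (elim z)
        have "(\<lambda>m. ennreal ((f m z - f n z)\<^sup>2)) \<longlonglongrightarrow> ennreal ((F z - f n z)\<^sup>2)"
          by (intro tendsto_intros elim)
        from lim_imp_Liminf[OF _ this] show ?case by (simp add: power2_commute)
      qed
    qed
    also have "\<dots> \<le> liminf (\<lambda>m. \<integral>\<^sup>+z. ennreal ((f m z - f n z)\<^sup>2) \<partial>lborel)"
      by (rule nn_integral_liminf) simp
    also have "\<dots> \<le> liminf (\<lambda>m::nat. ennreal ((2 * (1/2)^n)\<^sup>2))"
    proof (rule Liminf_mono)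
      show "\<forall>\<^sub>F m in sequentially. (\<integral>\<^sup>+z. ennreal ((f m z - f n z)\<^sup>2) \<partial>lborel) \<le> ennreal ((2 * (1/2)^n)\<^sup>2)"
        using eventually_ge_at_top[of n]
        by eventually_elim (auto simp only: nn intro!: ennreal_leI power_mono dist2 L2_norm_nonneg)
    qed
    also have "\<dots> = ennreal ((2 * (1/2)^n)\<^sup>2)" by (simp add: Liminf_const)
    finally show ?thesis .
  qed
  have sqd: "square_integrable (\<lambda>z. f n z - F z)" for n
    unfolding square_integrable_def
  proof
    show "integrable lborel (\<lambda>z. (f n z - F z)\<^sup>2)"
      using bd[of n] by (intro integrableI_nonneg) (auto simp: le_less_trans ennreal_less_top)
  qed simp
  have "square_integrable (\<lambda>z. f 0 z - (f 0 z - F z))"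
    by (intro square_integrable_diff f sqd)
  then have "square_integrable F" by simp
  have le2: "L2_norm (\<lambda>z. f n z - F z) \<le> 2 * (1/2)^n" for n
  proof (rule power2_le_imp_le)
    have "ennreal ((L2_norm (\<lambda>z. f n z - F z))\<^sup>2) = (\<integral>\<^sup>+z. ennreal ((f n z - F z)\<^sup>2) \<partial>lborel)"
      using sqd[of n] by (subst nn_integral_eq_integral) (auto simp: square_integrable_def L2_norm_power2)
    with bd[of n] have "ennreal ((L2_norm (\<lambda>z. f n z - F z))\<^sup>2) \<le> ennreal ((2 * (1/2)^n)\<^sup>2)"
      by metis
    then show "(L2_norm (\<lambda>z. f n z - F z))\<^sup>2 \<le> (2 * (1/2)^n)\<^sup>2"
      by (subst (asm) ennreal_le_iff) auto
  qed simp
  have "(\<lambda>n. L2_norm (\<lambda>z. f n z - F z)) \<longlonglongrightarrow> 0"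
  proof (rule Lim_null_comparison)
    show "\<forall>\<^sub>F n in sequentially. norm (L2_norm (\<lambda>z. f n z - F z)) \<le> 2 * (1/2)^n"
      by (simp add: le2)
    have "(\<lambda>n. 2 * (1/2)^n) \<longlonglongrightarrow> 2 * (0::real)"
      by (intro tendsto_mult tendsto_const LIMSEQ_realpow_zero) auto
    then show "(\<lambda>n. 2 * (1/2)^n) \<longlonglongrightarrow> (0::real)" by simp
  qed
  with \<open>square_integrable F\<close> show ?thesis by blast
qed

lemma Riesz_L2:
  assumes "continuous_L2_functional T"
  shows "\<exists>g. square_integrable g \<and> (\<forall>f. square_integrable f \<longrightarrow> T f = (LINT z|lborel. g z * f z))"
proof -
  obtain C where add: "\<And>f g. square_integrable f \<Longrightarrow> square_integrable g \<Longrightarrow> T (\<lambda>z. f z + g z) = T f + T g"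
    and cm: "\<And>c f. square_integrable f \<Longrightarrow> T (\<lambda>z. c * f z) = c * T f"
    and C: "\<And>f. square_integrable f \<Longrightarrow> \<bar>T f\<bar> \<le> C * L2_norm f"
    using assms unfolding continuous_L2_functional_def by blast
  have Tdiff: "T (\<lambda>z. f z - g z) = T f - T g" if "square_integrable f" "square_integrable g" for f g
    using add[OF that(1) square_integrable_cmult[OF that(2), of "-1"]] cm[OF that(2), of "-1"] by simp
  define J where "J f = (L2_norm f)\<^sup>2 / 2 - T f" for f
  define m where "m = Inf (J ` Collect square_integrable)"
  have zero: "square_integrable (\<lambda>_. 0)" by (simp add: square_integrable_def)
  have lb: "- C\<^sup>2 / 2 \<le> J f" if "square_integrable f" for f
    using C[OF that] zero_le_power2[of "L2_norm f - C"] unfolding J_def power2_diff by (simp add: algebra_simps)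
  have bdd: "bdd_below (J ` Collect square_integrable)"
    using lb by (intro bdd_belowI) auto
  have mle: "m \<le> J f" if "square_integrable f" for f
    unfolding m_def by (rule cInf_lower[OF _ bdd]) (use that in auto)
  have "\<exists>f. square_integrable f \<and> J f < m + e" if "e > 0" for e
    using cInf_lessD[of "J ` Collect square_integrable" "m + e"] that zero m_def by auto
  then have "\<forall>n::nat. \<exists>f. square_integrable f \<and> J f < m + (1/4)^n / 8" by simp
  then obtain f where f: "\<And>n. square_integrable (f n)" and Jf: "\<And>n. J (f n) < m + (1/4)^n / 8"
    by metis
  have par: "(L2_norm (\<lambda>z. p z - q z))\<^sup>2 \<le> 4 * (J p + J q - 2 * m)"
    if p: "square_integrable p" and q: "square_integrable q" for p q
  proof -
    have s: "square_integrable (\<lambda>z. (1/2) * (p z + q z))"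
      by (intro square_integrable_cmult square_integrable_add p q)
    have "m \<le> J (\<lambda>z. (1/2) * (p z + q z))" by (rule mle[OF s])
    also have "\<dots> = (L2_norm (\<lambda>z. p z + q z))\<^sup>2 / 8 - (T p + T q) / 2"
      unfolding J_def L2_norm_cmult cm[OF square_integrable_add[OF p q]] add[OF p q]
      by (simp add: power_mult_distrib power_divide)
    finally show ?thesis
      using L2_norm_add_power2[OF p q] L2_norm_diff_power2[OF p q] by (simp add: J_def field_simps)
  qed
  have "L2_norm (\<lambda>z. f (Suc n) z - f n z) \<le> (1/2)^n" for n
  proof (rule power2_le_imp_le)
    have "(L2_norm (\<lambda>z. f (Suc n) z - f n z))\<^sup>2 \<le> 4 * ((1/4)^Suc n / 8 + (1/4)^n / 8)"
      using par[OF f f, of "Suc n" n] Jf[of n] Jf[of "Suc n"] by argo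
    also have "\<dots> \<le> (1/4)^n" by simp
    also have "\<dots> = ((1/2)^n)\<^sup>2" by (simp add: power_mult[symmetric] power2_eq_square power_mult_distrib[symmetric])
    finally show "(L2_norm (\<lambda>z. f (Suc n) z - f n z))\<^sup>2 \<le> ((1/2)^n)\<^sup>2" .
  qed simp
  then obtain g where g: "square_integrable g" and lim: "(\<lambda>n. L2_norm (\<lambda>z. f n z - g z)) \<longlonglongrightarrow> 0"
    using L2_complete[of f] f by blast
  have Jg: "J g \<le> m"
  proof (rule LIMSEQ_le)
    have e: "J (f n) = J g + (L2_norm (\<lambda>z. f n z - g z))\<^sup>2 / 2 + (LINT z|lborel. g z * (f n z - g z)) - T (\<lambda>z. f n z - g z)" for n
      using L2_norm_add_power2[OF g square_integrable_diff[OF f g], of n] Tdiff[OF f g, of n]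
      by (simp add: J_def field_simps)
    have a: "(\<lambda>n. LINT z|lborel. g z * (f n z - g z)) \<longlonglongrightarrow> 0"
      by (rule Lim_null_comparison[where g="\<lambda>n. L2_norm g * L2_norm (\<lambda>z. f n z - g z)"])
        (auto intro!: always_eventually Cauchy_Schwarz_L2 g square_integrable_diff f tendsto_eq_intros lim)
    have b: "(\<lambda>n. T (\<lambda>z. f n z - g z)) \<longlonglongrightarrow> 0"
      by (rule Lim_null_comparison[where g="\<lambda>n. C * L2_norm (\<lambda>z. f n z - g z)"])
        (auto intro!: always_eventually C g square_integrable_diff f tendsto_eq_intros lim)
    have "(\<lambda>n. J g + (L2_norm (\<lambda>z. f n z - g z))\<^sup>2 / 2 + (LINT z|lborel. g z * (f n z - g z)) - T (\<lambda>z. f n z - g z)) \<longlonglongrightarrow> J g + 0\<^sup>2 / 2 + 0 - 0"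
      by (intro tendsto_intros lim a b) simp
    then show "(\<lambda>n. J (f n)) \<longlonglongrightarrow> J g" by (simp only: e[symmetric]) simp
    have "(\<lambda>n. m + (1/4)^n / 8) \<longlonglongrightarrow> m + 0 / 8"
      by (intro tendsto_intros LIMSEQ_realpow_zero) auto
    then show "(\<lambda>n. m + (1/4)^n / 8) \<longlonglongrightarrow> m" by simp
    show "\<exists>N. \<forall>n\<ge>N. J (f n) \<le> m + (1/4)^n / 8"
      using Jf less_imp_le by blast
  qed
  have "T h = (LINT z|lborel. g z * h z)" if h: "square_integrable h" for h
  proof -
    let ?B = "(LINT z|lborel. g z * h z) - T h"
    have "0 \<le> t * ?B + t\<^sup>2 * (L2_norm h)\<^sup>2 / 2" for t
    proof -
      have "J g \<le> J (\<lambda>z. g z + t * h z)"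
        using Jg mle[OF square_integrable_add[OF g square_integrable_cmult[OF h]], of t] by simp
      then show ?thesis
        using L2_norm_add_cmult_power2[OF g h, of t]
          add[OF g square_integrable_cmult[OF h], of t] cm[OF h, of t]
        by (simp add: J_def field_simps)
    qed
    note q = this
    have "?B = 0"
    proof (rule ccontr)
      assume B: "?B \<noteq> 0"
      define N where "N = (L2_norm h)\<^sup>2 + 1"
      have N: "N > 0" by (simp add: N_def add_nonneg_pos)
      have "0 \<le> (- ?B / N) * ?B + (- ?B / N)\<^sup>2 * (L2_norm h)\<^sup>2 / 2" by (rule q)
      also have "\<dots> \<le> (- ?B / N) * ?B + (- ?B / N)\<^sup>2 * N / 2"
        by (intro add_left_mono divide_right_mono mult_left_mono) (auto simp: N_def)
      also have "\<dots> = - ?B\<^sup>2 / (2 * N)" using N by (simp add: power2_eq_square field_simps)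
      also have "\<dots> < 0" using B N by (simp add: divide_neg_pos)
      finally show False by simp
    qed
    then show ?thesis by simp
  qed
  then show ?thesis using g by blast
qed

section \<open>Test functions\<close>

lemma C_k_SucI:
  assumes "\<And>z. (f has_derivative f' z) (at z)" "\<And>v. C_k k (\<lambda>z. f' z v)"
  shows "C_k (Suc k) f"
proof -
  have "frechet_derivative f (at z) = f' z" for z
    using frechet_derivative_at[OF assms(1)[of z]] by simp
  then show ?thesis using assms by (auto simp: differentiable_def)
qed

lemma C_k_Suc_D: "C_k (Suc k) f \<Longrightarrow> (f has_derivative frechet_derivative f (at z)) (at z)"
  by (simp add: frechet_derivative_works)

lemma C_k_Suc_imp: "C_k (Suc k) f \<Longrightarrow> C_k k f"
proof (induction k arbitrary: f)
  case 0
  then show ?case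
    by (auto intro!: continuous_at_imp_continuous_on differentiable_imp_continuous_within)
next
  case (Suc k)
  then show ?case using C_k.simps(2)[of "Suc k" f] C_k.simps(2)[of k f] by blast
qed

lemma C_k_const: "C_k k (\<lambda>z. c)"
proof (induction k arbitrary: c)
  case (Suc k)
  then show ?case by (intro C_k_SucI[where f'="\<lambda>_ _. 0"]) auto
qed simp

lemma C_k_bounded_linear: "bounded_linear f \<Longrightarrow> C_k k f"
proof (induction k)
  case 0 then show ?case by (simp add: linear_continuous_on)
next
  case (Suc k)
  then show ?case
    by (intro C_k_SucI[where f'="\<lambda>_. f"] bounded_linear_imp_has_derivative C_k_const)
qed

lemma C_k_add: "C_k k f \<Longrightarrow> C_k k g \<Longrightarrow> C_k k (\<lambda>z. f z + g z)"
proof (induction k arbitrary: f g)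
  case 0 then show ?case by (simp add: continuous_on_add)
next
  case (Suc k)
  then show ?case
    by (intro C_k_SucI[OF has_derivative_add[OF C_k_Suc_D C_k_Suc_D]]) auto
qed

lemma C_k_mult: "C_k k f \<Longrightarrow> C_k k g \<Longrightarrow> C_k k (\<lambda>z. f z * g z)"
proof (induction k arbitrary: f g)
  case 0 then show ?case by (simp add: continuous_on_mult)
next
  case (Suc k)
  show ?case
    by (rule C_k_SucI[OF has_derivative_mult[OF C_k_Suc_D[OF Suc.prems(1)] C_k_Suc_D[OF Suc.prems(2)]]],
        intro C_k_add Suc.IH C_k_Suc_imp[OF Suc.prems(1)] C_k_Suc_imp[OF Suc.prems(2)])
      (use Suc.prems in auto)
qed

lemma C_k_scale: "C_k k f \<Longrightarrow> C_k k (\<lambda>z. f (r *\<^sub>R z))"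
proof (induction k arbitrary: f)
  case 0
  then show ?case
    by (auto intro!: continuous_on_compose2[of UNIV f] continuous_intros)
next
  case (Suc k)
  have d: "((\<lambda>z. f (r *\<^sub>R z)) has_derivative (\<lambda>v. r * frechet_derivative f (at (r *\<^sub>R z)) v)) (at z)" for z
  proof -
    have "((\<lambda>z. r *\<^sub>R z) has_derivative (\<lambda>v. r *\<^sub>R v)) (at z)"
      by (auto intro!: derivative_eq_intros)
    from has_derivative_compose[OF this C_k_Suc_D[OF Suc.prems]]
    show ?thesis
      using linear_scale[OF has_derivative_linear[OF C_k_Suc_D[OF Suc.prems]]] by simp
  qed
  show ?case
    by (rule C_k_SucI[OF d], intro C_k_mult C_k_const Suc.IH) (use Suc.prems in auto)
qed

lemma C_k_polynomial: "real_polynomial_function p \<Longrightarrow> C_k k p"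
  by (induction rule: real_polynomial_function.induct)
    (auto intro: C_k_add C_k_mult C_k_const C_k_bounded_linear)

text \<open>The powers in the denominator make this family closed under differentiation.\<close>

definition flat :: "nat \<Rightarrow> real \<Rightarrow> real" where
  "flat n x = (if 0 < x then exp (- 1 / x) / x ^ n else 0)"

lemma flat_tendsto_0: "(flat n \<longlongrightarrow> 0) (at 0)"
proof -
  have "((\<lambda>x. inverse x ^ n / exp (inverse x)) \<longlongrightarrow> (0::real)) (at_right 0)"
    by (rule filterlim_compose[OF tendsto_power_div_exp_0 filterlim_inverse_at_top_right])
  moreover have "\<forall>\<^sub>F x in at_right 0. inverse x ^ n / exp (inverse x) = flat n x"
    using eventually_at_right_less[of 0]
    by eventually_elim (simp add: flat_def exp_minus field_simps)
  ultimately have "(flat n \<longlongrightarrow> 0) (at_right 0)"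
    by (rule Lim_transform_eventually)
  moreover have "(flat n \<longlongrightarrow> 0) (at_left 0)"
    by (rule Lim_transform_eventually[OF tendsto_const])
      (auto simp: eventually_at_filter flat_def intro!: always_eventually)
  ultimately show ?thesis by (simp add: filterlim_split_at)
qed

lemma flat_deriv:
  "(flat n has_real_derivative flat (n + 2) x - real n * flat (n + 1) x) (at x)"
proof (cases x "0::real" rule: linorder_cases)
  case less
  have "((\<lambda>_. 0) has_real_derivative 0) (at x)" by simp
  then have "(flat n has_real_derivative 0) (at x)"
    by (rule has_field_derivative_transform_within_open[where S="{..<0}"]) (use less in \<open>auto simp: flat_def\<close>)
  then show ?thesis using less by (simp add: flat_def)
next
  case equal
  have "(\<lambda>y. (flat n y - flat n 0) / (y - 0)) = flat (n + 1)"
    by (auto simp: flat_def)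
  then have "(flat n has_real_derivative 0) (at 0)"
    using flat_tendsto_0[of "n + 1"] by (simp add: has_field_derivative_iff)
  then show ?thesis using equal by (simp add: flat_def)
next
  case greater
  have "((\<lambda>x. exp (- 1 / x) * inverse x ^ n) has_real_derivative flat (n + 2) x - real n * flat (n + 1) x) (at x)"
    using greater
    by (auto intro!: derivative_eq_intros simp: flat_def)
      (cases n; simp add: field_simps power2_eq_square)
  then show ?thesis
    by (rule has_field_derivative_transform_within_open[where S="{0<..}"])
      (use greater in \<open>auto simp: flat_def field_simps\<close>)
qed

lemma continuous_on_flat: "continuous_on UNIV (flat n)"
  using flat_deriv by (intro continuous_at_imp_continuous_on) (auto intro: DERIV_isCont)

definition bump :: "real \<Rightarrow> complex \<Rightarrow> real" where
  "bump R z = exp 1 * flat 0 (1 - (norm z)\<^sup>2 / R\<^sup>2)"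

lemma bump_bounds: "0 \<le> bump R z" "bump R z \<le> 1"
proof -
  have "exp (1::real) * exp (- 1 / x) \<le> 1" if "0 < x" "x \<le> 1" for x
    using that by (simp add: mult_exp_exp field_simps)
  then show "bump R z \<le> 1" by (auto simp: bump_def flat_def)
qed (simp add: bump_def flat_def)

lemma bump_eq_0: "0 < R \<Longrightarrow> R \<le> norm z \<Longrightarrow> bump R z = 0"
  by (auto simp: bump_def flat_def not_less field_simps power_mono)

lemma bump_tendsto_1: "(\<lambda>n. bump (real (Suc n)) z) \<longlonglongrightarrow> 1"
proof -
  have "(\<lambda>n. bump (real (Suc n)) z) \<longlonglongrightarrow> exp 1 * flat 0 (1 - 0)"
    unfolding bump_def
  proof (intro tendsto_intros isCont_tendsto_compose[of _ "flat 0"])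
    show "isCont (flat 0) (1 - 0)" using DERIV_isCont[OF flat_deriv] .
    have "(\<lambda>n. (norm z)\<^sup>2 * (inverse (real (Suc n)))\<^sup>2) \<longlonglongrightarrow> (norm z)\<^sup>2 * 0\<^sup>2"
      by (intro tendsto_intros LIMSEQ_inverse_real_of_nat)
    then show "(\<lambda>n. (norm z)\<^sup>2 / (real (Suc n))\<^sup>2) \<longlonglongrightarrow> 0"
      by (simp add: divide_inverse power_inverse)
  qed
  moreover have "exp 1 * flat 0 (1 - 0) = 1" by (simp add: flat_def exp_minus)
  ultimately show ?thesis by simp
qed

lemma flat_radial_deriv:
  "((\<lambda>z::complex. flat n (1 - (norm z)\<^sup>2 / R\<^sup>2)) has_derivative
    (\<lambda>v. (flat (n + 2) (1 - (norm z)\<^sup>2 / R\<^sup>2) + - real n * flat (n + 1) (1 - (norm z)\<^sup>2 / R\<^sup>2))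
      * ((- 2 / R\<^sup>2) * (z \<bullet> v)))) (at z)"
proof -
  have "((\<lambda>z::complex. 1 - (z \<bullet> z) * inverse (R\<^sup>2)) has_derivative (\<lambda>v. - 2 * inverse (R\<^sup>2) * (z \<bullet> v))) (at z)"
    by (auto intro!: derivative_eq_intros simp: inner_commute)
  from has_derivative_compose[OF this flat_deriv[unfolded has_field_derivative_def]]
  show ?thesis by (simp add: power2_norm_eq_inner divide_inverse)
qed

lemma C_k_flat: "C_k k (\<lambda>z. flat n (1 - (norm z)\<^sup>2 / R\<^sup>2))"
proof (induction k arbitrary: n)
  case 0
  show ?case
    by (auto intro!: continuous_on_compose2[OF continuous_on_flat] continuous_intros simp: divide_inverse)
next
  case (Suc k)
  show ?case
    by (rule C_k_SucI[OF flat_radial_deriv], intro C_k_mult C_k_add C_k_const Suc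
        C_k_bounded_linear bounded_linear_inner_left)
qed

lemma C_k_bump: "C_k k (bump R)"
  unfolding bump_def by (intro C_k_mult C_k_const C_k_flat)

lemma test_function_C_k: "test_function f \<Longrightarrow> C_k k f"
  by (simp add: test_function_def)

lemma test_functionI:
  assumes "\<And>k. C_k k f" "\<And>z. R \<le> norm z \<Longrightarrow> f z = 0"
  shows "test_function f"
proof -
  have "{z. f z \<noteq> 0} \<subseteq> cball 0 R" using assms(2) by (force simp: not_le[symmetric])
  then have "bounded {z. f z \<noteq> 0}" using bounded_cball bounded_subset by blast
  then show ?thesis by (simp add: test_function_def assms(1))
qed

lemma test_function_support:
  assumes "test_function f"
  obtains R where "0 < R" "\<And>z. R \<le> norm z \<Longrightarrow> f z = 0"
proof -
  have "bounded {z. f z \<noteq> 0}"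
    using assms bounded_subset[OF compact_imp_bounded closure_subset] by (auto simp: test_function_def)
  then obtain b where "b > 0" "\<And>z. f z \<noteq> 0 \<Longrightarrow> norm z \<le> b" by (auto simp: bounded_pos)
  then show ?thesis by (intro that[of "b + 1"]) (auto, fastforce)
qed

lemma square_integrable_compact_support:
  assumes "continuous_on UNIV f" "\<And>z. R \<le> norm z \<Longrightarrow> f z = 0"
  shows "square_integrable f"
proof -
  have [measurable]: "f \<in> borel_measurable lborel" 
    using borel_measurable_continuous_onI[OF assms(1)] by simp
  have "set_integrable lborel (cball 0 R) (\<lambda>z. (f z)\<^sup>2)"
    using borel_integrable_compact[of "cball 0 R" "\<lambda>z. (f z)\<^sup>2"] assms(1)
    by (auto simp: set_integrable_def intro!: continuous_intros continuous_on_subset[OF assms(1)])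
  moreover have "(\<lambda>z. indicat_real (cball 0 R) z *\<^sub>R (f z)\<^sup>2) = (\<lambda>z. (f z)\<^sup>2)"
  proof
    fix z show "indicat_real (cball 0 R) z *\<^sub>R (f z)\<^sup>2 = (f z)\<^sup>2"
      using assms(2)[of z] by (cases "norm z \<le> R") auto
  qed
  ultimately show ?thesis by (simp add: square_integrable_def set_integrable_def)
qed

lemma test_function_continuous: "test_function f \<Longrightarrow> continuous_on UNIV f"
  using test_function_C_k[of f 0] by simp

lemma test_function_square_integrable: "test_function f \<Longrightarrow> square_integrable f"
  by (metis square_integrable_compact_support test_function_support test_function_continuous)

lemma test_function_scale:
  assumes "test_function f" "0 < r"
  shows "test_function (\<lambda>z. c * f (r *\<^sub>R z))"
proof -
  obtain R where R: "0 < R" "\<And>z. R \<le> norm z \<Longrightarrow> f z = 0" using test_function_support assms(1) by blast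
  show ?thesis
  proof (rule test_functionI)
    show "C_k k (\<lambda>z. c * f (r *\<^sub>R z))" for k
      by (rule C_k_mult[OF C_k_const C_k_scale[OF test_function_C_k[OF assms(1)]]])
    show "c * f (r *\<^sub>R z) = 0" if "R / r \<le> norm z" for z
      using R(2)[of "r *\<^sub>R z"] that assms(2) by (simp add: field_simps)
  qed
qed

text \<open>\<open>F\<close> times a cutoff is approximated by test functions without mollification: they are a polynomial
  close to \<open>F\<close> on a disc (Stone-Weierstrass) times the cutoff.\<close>

lemma L2_norm_le_of_test_functions:
  assumes cF: "continuous_on UNIV F" and F: "square_integrable F" and C: "0 \<le> C"
    and le: "\<And>\<phi>. test_function \<phi> \<Longrightarrow> \<bar>LINT z|lborel. F z * \<phi> z\<bar> \<le> C * L2_norm \<phi>"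
  shows "L2_norm F \<le> C"
proof -
  have bumped: "(LINT z|lborel. (F z)\<^sup>2 * bump R z) \<le> C\<^sup>2" if R: "0 < R" for R
  proof -
    let ?b = "bump R"
    have [continuous_intros]: "continuous_on S F" "continuous_on S ?b" for S
      using continuous_on_subset[OF cF] C_k_bump[of 0 R] continuous_on_subset[of UNIV ?b S] by auto
    have bz: "R \<le> norm z \<Longrightarrow> ?b z = 0" for z using bump_eq_0[OF R] by blast
    have sFb: "square_integrable (\<lambda>z. F z * ?b z)"
      by (rule square_integrable_compact_support[of _ R]) (auto intro!: continuous_intros simp: bz)
    define X where "X = (LINT z|lborel. (F z)\<^sup>2 * ?b z)"
    have iX: "integrable lborel (\<lambda>z. (F z)\<^sup>2 * ?b z)"
      using square_integrable_mult[OF F sFb] by (simp add: power2_eq_square mult.assoc)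
    have X0: "0 \<le> X" unfolding X_def by (rule integral_nonneg_AE) (simp add: bump_bounds)
    have nFb: "L2_norm (\<lambda>z. F z * ?b z) \<le> sqrt X"
      unfolding L2_norm_def X_def
    proof (intro real_sqrt_le_mono integral_mono iX)
      show "integrable lborel (\<lambda>z. (F z * ?b z)\<^sup>2)" using sFb by (simp add: square_integrable_def)
      fix z
      have "?b z * ?b z \<le> ?b z" using bump_bounds[of R z] by (simp add: mult_left_le)
      then show "(F z * ?b z)\<^sup>2 \<le> (F z)\<^sup>2 * ?b z"
        by (simp add: power_mult_distrib mult_left_mono power2_eq_square[of "?b z"])
    qed
    define K where "K = (C + L2_norm F) * L2_norm (indicat_real (cball 0 R))"
    have sI: "square_integrable (indicat_real (cball (0::complex) R))"
      using emeasure_bounded_finite[OF bounded_cball, of "0::complex" R]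
      by (auto simp: square_integrable_def power2_eq_square indicator_inter_arith[symmetric]
          intro!: borel_measurable_indicator)
    have "X \<le> C * sqrt X + e * K" if e: "0 < e" for e
    proof -
      obtain p where p: "real_polynomial_function p" "\<And>z. z \<in> cball 0 R \<Longrightarrow> \<bar>F z - p z\<bar> < e"
        using Stone_Weierstrass_real_polynomial_function[of "cball 0 R" F e] e
        by (auto intro: continuous_intros)
      define D where "D = (\<lambda>z. (p z - F z) * ?b z)"
      have tp: "test_function (\<lambda>z. p z * ?b z)"
        by (rule test_functionI[of _ R]) (auto intro: C_k_mult[OF C_k_polynomial[OF p(1)] C_k_bump] simp: bz)
      have [continuous_intros]: "continuous_on S p" for S
        using C_k_polynomial[OF p(1), of 0] continuous_on_subset[of UNIV p S] by auto
      have sD: "square_integrable D" unfolding D_def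
        by (rule square_integrable_compact_support[of _ R]) (auto intro!: continuous_intros simp: bz)
      have "L2_norm D \<le> L2_norm (\<lambda>z. e * indicat_real (cball 0 R) z)"
        unfolding L2_norm_def
      proof (intro real_sqrt_le_mono integral_mono)
        show "integrable lborel (\<lambda>z. (D z)\<^sup>2)"
          "integrable lborel (\<lambda>z. (e * indicat_real (cball (0::complex) R) z)\<^sup>2)"
          using sD square_integrable_cmult[OF sI, of e] by (simp_all add: square_integrable_def)
        fix z
        have "\<bar>D z\<bar> \<le> e" if "norm z \<le> R"
        proof -
          have "\<bar>D z\<bar> \<le> \<bar>p z - F z\<bar> * 1"
            unfolding D_def abs_mult using bump_bounds[of R z] by (intro mult_left_mono) auto
          then show ?thesis using p(2)[of z] that by simp
        qed
        then have "\<bar>D z\<bar> \<le> \<bar>e * indicat_real (cball 0 R) z\<bar>"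
          using e by (cases "norm z \<le> R") (auto simp: D_def bz indicator_def)
        then show "(D z)\<^sup>2 \<le> (e * indicat_real (cball 0 R) z)\<^sup>2" by (simp only: abs_le_square_iff)
      qed
      then have nD: "L2_norm D \<le> e * L2_norm (indicat_real (cball 0 R))"
        using e by (simp add: L2_norm_cmult)
      have eqp: "(\<lambda>z. p z * ?b z) = (\<lambda>z. F z * ?b z + D z)" by (auto simp: D_def algebra_simps)
      have "(LINT z|lborel. F z * (p z * ?b z)) = (LINT z|lborel. (F z)\<^sup>2 * ?b z + F z * D z)"
        by (intro Bochner_Integration.integral_cong) (auto simp: D_def algebra_simps power2_eq_square)
      also have "\<dots> = X + (LINT z|lborel. F z * D z)"
        unfolding X_def by (intro Bochner_Integration.integral_add iX square_integrable_mult F sD)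
      finally have "X + (LINT z|lborel. F z * D z) \<le> C * L2_norm (\<lambda>z. p z * ?b z)"
        using le[OF tp] by linarith
      also have "\<dots> \<le> C * (sqrt X + L2_norm D)"
        unfolding eqp using L2_norm_triangle[OF sFb sD] nFb by (intro mult_left_mono C) linarith
      finally have "X \<le> C * sqrt X + C * L2_norm D + L2_norm F * L2_norm D"
        using Cauchy_Schwarz_L2[OF F sD] by (simp add: algebra_simps)
      also have "\<dots> = C * sqrt X + (C + L2_norm F) * L2_norm D" by (simp add: algebra_simps)
      also have "\<dots> \<le> C * sqrt X + (C + L2_norm F) * (e * L2_norm (indicat_real (cball 0 R)))"
        by (intro add_left_mono mult_left_mono nD) (simp add: C)
      finally show ?thesis by (simp add: K_def algebra_simps)
    qed
    note eps = this
    have K0: "0 \<le> K" by (simp add: K_def C)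
    have "X \<le> C * sqrt X"
    proof (rule field_le_epsilon)
      fix d :: real assume "0 < d"
      then have "X \<le> C * sqrt X + (d / (K + 1)) * K" using K0 by (intro eps) simp
      also have "(d / (K + 1)) * K \<le> d" using K0 \<open>0 < d\<close> by (simp add: field_simps)
      finally show "X \<le> C * sqrt X + d" by simp
    qed
    then have "sqrt X * sqrt X \<le> C * sqrt X" using X0 by simp
    then have "sqrt X \<le> C" using C X0 mult_right_le_imp_le[of "sqrt X" "sqrt X" C] by (cases "X = 0") (auto simp del: real_sqrt_mult_self)
    then have "(sqrt X)\<^sup>2 \<le> C\<^sup>2" using X0 by (intro power_mono) auto
    then show ?thesis using X0 by (simp add: X_def)
  qed
  have "(\<lambda>n. LINT z|lborel. (F z)\<^sup>2 * bump (real (Suc n)) z) \<longlonglongrightarrow> (LINT z|lborel. (F z)\<^sup>2)"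
  proof (rule integral_dominated_convergence[where w="\<lambda>z. (F z)\<^sup>2"])
    have m: "bump R \<in> borel_measurable lborel" for R
      using C_k_bump[of 0 R] borel_measurable_continuous_onI[of "bump R"] by simp
    show "(\<lambda>z. (F z)\<^sup>2 * bump (real (Suc n)) z) \<in> borel_measurable lborel" for n
      using F m by (auto simp: square_integrable_def)
    show "integrable lborel (\<lambda>z. (F z)\<^sup>2)" "(\<lambda>z. (F z)\<^sup>2) \<in> borel_measurable lborel"
      using F by (auto simp: square_integrable_def)
    show "AE z in lborel. norm ((F z)\<^sup>2 * bump (real (Suc n)) z) \<le> (F z)\<^sup>2" for n
      by (auto simp: abs_mult bump_bounds mult_left_le)
    have "(\<lambda>n. (F z)\<^sup>2 * bump (real (Suc n)) z) \<longlonglongrightarrow> (F z)\<^sup>2 * 1" for z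
      by (intro tendsto_mult tendsto_const bump_tendsto_1)
    then show "AE z in lborel. (\<lambda>n. (F z)\<^sup>2 * bump (real (Suc n)) z) \<longlonglongrightarrow> (F z)\<^sup>2" by simp
  qed
  then have "(LINT z|lborel. (F z)\<^sup>2) \<le> C\<^sup>2"
    by (rule LIMSEQ_le_const2) (use bumped in auto)
  then have "sqrt (LINT z|lborel. (F z)\<^sup>2) \<le> sqrt (C\<^sup>2)" by (rule real_sqrt_le_mono)
  then show ?thesis using C by (simp add: L2_norm_def)
qed

section \<open>Dilations\<close>

lemma integral_lborel_scale:
  fixes f :: "complex \<Rightarrow> real"
  assumes [measurable]: "f \<in> borel_measurable borel" and r: "0 < r"
  shows "(LINT z|lborel. f (r *\<^sub>R z)) = (LINT z|lborel. f z) / r\<^sup>2"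
    and "integrable lborel f \<Longrightarrow> integrable lborel (\<lambda>z. f (r *\<^sub>R z))"
proof -
  have eq: "(lborel :: complex measure) = density (distr lborel borel (\<lambda>x. r *\<^sub>R x)) (\<lambda>_. ennreal (r\<^sup>2))"
    using lborel_affine[of r "0::complex"] r by simp
  have "(LINT z|lborel. f z) = (LINT z|density (distr lborel borel (\<lambda>x. r *\<^sub>R x)) (\<lambda>_. ennreal (r\<^sup>2)). f z)"
    by (subst eq) (rule refl)
  also have "\<dots> = r\<^sup>2 * (LINT z|lborel. f (r *\<^sub>R z))"
    by (subst integral_density) (auto simp: integral_distr)
  finally show "(LINT z|lborel. f (r *\<^sub>R z)) = (LINT z|lborel. f z) / r\<^sup>2" using r by simp
  assume "integrable lborel f"
  then have "integrable (density (distr lborel borel (\<lambda>x. r *\<^sub>R x)) (\<lambda>_. ennreal (r\<^sup>2))) f"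
    by (subst (asm) eq)
  then have "integrable lborel (\<lambda>z. r\<^sup>2 * f (r *\<^sub>R z))"
    by (subst (asm) integrable_density) (auto simp: integrable_distr_eq)
  then show "integrable lborel (\<lambda>z. f (r *\<^sub>R z))" using r by simp
qed

lemma square_integrable_scale:
  assumes "square_integrable f" "0 < r"
  shows "square_integrable (\<lambda>z. f (r *\<^sub>R z))"
proof -
  have [measurable]: "f \<in> borel_measurable borel" using assms by (simp add: square_integrable_def)
  show ?thesis
    using integral_lborel_scale(2)[of "\<lambda>z. (f z)\<^sup>2" r] assms by (auto simp: square_integrable_def)
qed

lemma L2_norm_scale:
  assumes "square_integrable f" "0 < r"
  shows "L2_norm (\<lambda>z. f (r *\<^sub>R z)) = L2_norm f / r"
proof -
  have [measurable]: "f \<in> borel_measurable borel" using assms by (simp add: square_integrable_def)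
  show ?thesis
    using integral_lborel_scale(1)[of "\<lambda>z. (f z)\<^sup>2" r] assms
    by (simp add: L2_norm_def real_sqrt_divide)
qed

lemma lborel_integral_eq_integral_cbox:
  fixes f :: "'a::euclidean_space \<Rightarrow> real"
  assumes "continuous_on UNIV f" "\<And>z. z \<notin> cbox a b \<Longrightarrow> f z = 0"
  shows "(LINT z|lborel. f z) = integral (cbox a b) f" and "integrable lborel f"
proof -
  have c: "continuous_on (cbox a b) f" using assms(1) continuous_on_subset by blast
  have i: "set_integrable lborel (cbox a b) f"
    unfolding set_integrable_def using borel_integrable_compact[OF compact_cbox c] by simp
  have eq: "(\<lambda>z. indicat_real (cbox a b) z *\<^sub>R f z) = f"
  proof
    fix z show "indicat_real (cbox a b) z *\<^sub>R f z = f z"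
      using assms(2)[of z] by (cases "z \<in> cbox a b") auto
  qed
  show "integrable lborel f" using i by (simp only: set_integrable_def eq)
  show "(LINT z|lborel. f z) = integral (cbox a b) f"
    using set_borel_integral_eq_integral(2)[OF i] by (simp only: set_lebesgue_integral_def eq)
qed

definition has_radial_derivative :: "(complex \<Rightarrow> real) \<Rightarrow> (complex \<Rightarrow> real) \<Rightarrow> bool" where
  "has_radial_derivative f f' \<longleftrightarrow>
     (\<forall>z r. 0 < r \<longrightarrow> ((\<lambda>s. f (s *\<^sub>R z)) has_real_derivative f' (r *\<^sub>R z) / r) (at r))"

lemma has_radial_derivative_mult:
  assumes "has_radial_derivative f f'" "has_radial_derivative g g'"
  shows "has_radial_derivative (\<lambda>z. f z * g z) (\<lambda>z. f' z * g z + f z * g' z)"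
  using assms unfolding has_radial_derivative_def
  by (auto intro!: derivative_eq_intros simp: add_divide_distrib)

lemma deriv_integral_scale:
  assumes H: "continuous_on UNIV H" and f: "continuous_on UNIV f" "continuous_on UNIV f'"
    and supp: "\<And>z. R \<le> norm z \<Longrightarrow> f z = 0" "\<And>z. R \<le> norm z \<Longrightarrow> f' z = 0"
    and d: "has_radial_derivative f f'" and r: "0 < r"
  shows "((\<lambda>s. LINT z|lborel. H z * f (s *\<^sub>R z)) has_real_derivative
    (LINT z|lborel. H z * f' (r *\<^sub>R z)) / r) (at r)"
proof -
  obtain a where a: "cball (0::complex) (2 * R / r) \<subseteq> cbox (-a) a"
    using bounded_subset_cbox_symmetric[OF bounded_cball] by blast
  have big: "R \<le> norm (s *\<^sub>R z)" if "r / 2 < s" "z \<notin> cbox (-a) a" for s z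
  proof -
    have "2 * R / r < norm z" using a that(2) by (force simp: not_le[symmetric])
    then have "R < (r / 2) * norm z" using r by (simp add: field_simps)
    also have "\<dots> \<le> s * norm z" using that by (intro mult_right_mono) auto
    finally show ?thesis using that r by simp
  qed
  note [continuous_intros] = continuous_on_compose2[OF H] continuous_on_compose2[OF f(1)] continuous_on_compose2[OF f(2)]
  have eq: "(LINT z|lborel. H z * f (s *\<^sub>R z)) = integral (cbox (-a) a) (\<lambda>z. H z * f (s *\<^sub>R z))"
    if "s \<in> {r/2<..}" for s
    by (rule lborel_integral_eq_integral_cbox) (use that big supp in \<open>auto intro!: continuous_intros\<close>)
  have "((\<lambda>s. integral (cbox (-a) a) (\<lambda>z. H z * f (s *\<^sub>R z))) has_real_derivative
      integral (cbox (-a) a) (\<lambda>z. H z * (f' (r *\<^sub>R z) / r))) (at r within {r/2<..})"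
  proof (rule leibniz_rule_field_derivative)
    fix s z assume "s \<in> {r/2<..}"
    then have "((\<lambda>s. f (s *\<^sub>R z)) has_real_derivative f' (s *\<^sub>R z) / s) (at s)"
      using d r by (auto simp: has_radial_derivative_def)
    from DERIV_cmult[OF this, of "H z"]
    show "((\<lambda>s. H z * f (s *\<^sub>R z)) has_real_derivative H z * (f' (s *\<^sub>R z) / s)) (at s within {r/2<..})"
      by (rule has_field_derivative_at_within)
  qed (use r in \<open>auto intro!: integrable_continuous continuous_intros simp: split_beta\<close>)
  moreover have "at r within {r/2<..} = at r" using r by (intro at_within_open) auto
  moreover have "integral (cbox (-a) a) (\<lambda>z. H z * (f' (r *\<^sub>R z) / r)) = (LINT z|lborel. H z * f' (r *\<^sub>R z)) / r"
  proof -
    have "(LINT z|lborel. H z * (f' (r *\<^sub>R z) / r)) = integral (cbox (-a) a) (\<lambda>z. H z * (f' (r *\<^sub>R z) / r))"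
      by (rule lborel_integral_eq_integral_cbox) (use r big[of r] supp in \<open>auto intro!: continuous_intros\<close>)
    from this[symmetric] show ?thesis by simp
  qed
  ultimately have "((\<lambda>s. integral (cbox (-a) a) (\<lambda>z. H z * f (s *\<^sub>R z))) has_real_derivative
      (LINT z|lborel. H z * f' (r *\<^sub>R z)) / r) (at r)" by (simp only:)
  then show ?thesis
    by (rule has_field_derivative_transform_within_open[where S="{r/2<..}"]) (use r eq in auto)
qed

lemma divergence_scaleR_ident:
  assumes "(f has_derivative f') (at z)"
  shows "divergence (\<lambda>w. f w *\<^sub>R w) z = 2 * f z + f' z"
proof -
  have "((\<lambda>w. f w *\<^sub>R w) has_derivative (\<lambda>h. f z *\<^sub>R h + f' h *\<^sub>R z)) (at z)"
    using assms by (auto intro!: derivative_eq_intros)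
  then have "frechet_derivative (\<lambda>w. f w *\<^sub>R w) (at z) = (\<lambda>h. f z *\<^sub>R h + f' h *\<^sub>R z)"
    by (rule frechet_derivative_at[symmetric])
  moreover have "f' z = Re z * f' 1 + Im z * f' \<i>"
  proof -
    have l: "linear f'" using assms has_derivative_linear by blast
    have "z = Re z *\<^sub>R 1 + Im z *\<^sub>R \<i>" by (simp add: complex_eq_iff)
    then have "f' z = f' (Re z *\<^sub>R 1 + Im z *\<^sub>R \<i>)" by simp
    then show ?thesis by (simp add: linear_add[OF l] linear_scale[OF l])
  qed
  ultimately show ?thesis
    by (simp add: divergence_def Basis_complex_def inner_complex_def algebra_simps)
qed

lemma test_function_radial:
  assumes t: "test_function f"
  defines "f' \<equiv> \<lambda>z. frechet_derivative f (at z) z"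
  shows "continuous_on UNIV f'" "has_radial_derivative f f'" "divergence (\<lambda>w. f w *\<^sub>R w) z = 2 * f z + f' z"
    "(\<And>z. R < norm z \<Longrightarrow> f z = 0) \<Longrightarrow> R < norm z \<Longrightarrow> f' z = 0"
proof -
  have D: "(f has_derivative frechet_derivative f (at z)) (at z)" for z
    using C_k_Suc_D[OF test_function_C_k[OF t]] .
  have "f' = (\<lambda>z. Re z * frechet_derivative f (at z) 1 + Im z * frechet_derivative f (at z) \<i>)"
  proof
    fix z
    have l: "linear (frechet_derivative f (at z))" using D has_derivative_linear by blast
    have "z = Re z *\<^sub>R 1 + Im z *\<^sub>R \<i>" by (simp add: complex_eq_iff)
    then have "f' z = frechet_derivative f (at z) (Re z *\<^sub>R 1 + Im z *\<^sub>R \<i>)" by (simp add: f'_def)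
    then show "f' z = Re z * frechet_derivative f (at z) 1 + Im z * frechet_derivative f (at z) \<i>"
      by (simp only: linear_add[OF l] linear_scale[OF l] real_scaleR_def)
  qed
  moreover have "continuous_on UNIV (\<lambda>z. frechet_derivative f (at z) v)" for v
    using test_function_C_k[OF t, of "Suc 0"] by simp
  ultimately show "continuous_on UNIV f'" by (auto intro!: continuous_intros)
  show "has_radial_derivative f f'"
    unfolding has_radial_derivative_def
  proof (intro allI impI)
    fix z :: complex and r :: real assume r: "0 < r"
    have "((\<lambda>s. s *\<^sub>R z) has_derivative (\<lambda>h. h *\<^sub>R z)) (at r)" by (auto intro!: derivative_eq_intros)
    from has_derivative_compose[OF this D]
    have "((\<lambda>s. f (s *\<^sub>R z)) has_derivative (\<lambda>h. h * frechet_derivative f (at (r *\<^sub>R z)) z)) (at r)"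
      using linear_scale[OF has_derivative_linear[OF D]] by simp
    moreover have "f' (r *\<^sub>R z) / r = frechet_derivative f (at (r *\<^sub>R z)) z"
      using linear_scale[OF has_derivative_linear[OF D[of "r *\<^sub>R z"]], of r z] r by (simp add: f'_def)
    ultimately show "((\<lambda>s. f (s *\<^sub>R z)) has_real_derivative f' (r *\<^sub>R z) / r) (at r)"
      by (simp add: has_field_derivative_def mult.commute[of _ "frechet_derivative f (at (r *\<^sub>R z)) z"])
  qed
  show "divergence (\<lambda>w. f w *\<^sub>R w) z = 2 * f z + f' z"
    unfolding f'_def by (rule divergence_scaleR_ident[OF D])
  assume z: "\<And>z. R < norm z \<Longrightarrow> f z = 0" "R < norm z"
  have "((\<lambda>_. 0) has_derivative (\<lambda>_. 0)) (at z)" by simp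
  then have "(f has_derivative (\<lambda>_. 0)) (at z)"
    by (rule has_derivative_transform_within_open[where s="{z. R < norm z}"])
      (use z in \<open>auto intro!: open_Collect_less continuous_intros\<close>)
  then have "frechet_derivative f (at z) = (\<lambda>_. 0)" by (rule frechet_derivative_at[symmetric])
  then show "f' z = 0" by (simp add: f'_def)
qed

lemma abs_integral_scale_diff_le:
  assumes H: "continuous_on UNIV H" and C: "0 \<le> C"
    and dl: "\<And>\<phi>. test_function \<phi> \<Longrightarrow> \<bar>dl H \<phi>\<bar> \<le> C * L2_norm \<phi>"
    and t: "test_function f" and r: "0 < r" "r < 1"
  shows "\<bar>r\<^sup>2 * (LINT z|lborel. H z * f (r *\<^sub>R z)) - (LINT z|lborel. H z * f z)\<bar> \<le> (1 - r) * (C * L2_norm f)"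
proof -
  obtain R where R: "0 < R" "\<And>z. R \<le> norm z \<Longrightarrow> f z = 0" using test_function_support[OF t] by blast
  define f' where "f' = (\<lambda>z. frechet_derivative f (at z) z)"
  have f': "continuous_on UNIV f'" "has_radial_derivative f f'"
    using test_function_radial[OF t] by (simp_all add: f'_def)
  have f0: "f' z = 0" if "R + 1 \<le> norm z" for z
    using test_function_radial(4)[OF t, of R z] R(2) that by (simp add: f'_def)
  have cf: "continuous_on UNIV f" by (rule test_function_continuous[OF t])
  define B where "B s = (LINT z|lborel. H z * f (s *\<^sub>R z))" for s
  define D where "D s = (LINT z|lborel. H z * f' (s *\<^sub>R z))" for s
  have dB: "(B has_real_derivative D s / s) (at s)" if "0 < s" for s
    unfolding B_def D_def
    by (rule deriv_integral_scale[where R="R + 1"]) (use H cf f' f0 R(2) that in auto)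
  have dG: "((\<lambda>s. s\<^sup>2 * B s) has_real_derivative 2 * s * B s + s * D s) (at s)" if "0 < s" for s
    using dB[OF that] that by (auto intro!: derivative_eq_intros simp: power2_eq_square)
  have le: "\<bar>2 * s * B s + s * D s\<bar> \<le> C * L2_norm f" if s: "0 < s" for s
  proof -
    define h where "h = (\<lambda>z. s\<^sup>2 * f (s *\<^sub>R z))"
    have th: "test_function h" unfolding h_def by (rule test_function_scale[OF t s])
    note [continuous_intros] = continuous_on_compose2[OF H] continuous_on_compose2[OF cf] continuous_on_compose2[OF f'(1)]
    obtain a where a: "cball (0::complex) ((R + 1) / s) \<subseteq> cbox (-a) a"
      using bounded_subset_cbox_symmetric[OF bounded_cball] by blast
    have big: "R + 1 \<le> norm (s *\<^sub>R z)" if "z \<notin> cbox (-a) a" for z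
    proof -
      have "(R + 1) / s < norm z" using a that by (force simp: not_le[symmetric])
      then show ?thesis using s by (simp add: field_simps)
    qed
    have i: "integrable lborel (\<lambda>z. H z * f (s *\<^sub>R z))" "integrable lborel (\<lambda>z. H z * f' (s *\<^sub>R z))"
    proof -
      have "f (s *\<^sub>R z) = 0" "f' (s *\<^sub>R z) = 0" if "z \<notin> cbox (-a) a" for z
        using R(2)[of "s *\<^sub>R z"] f0[of "s *\<^sub>R z"] big[OF that] by auto
      then show "integrable lborel (\<lambda>z. H z * f (s *\<^sub>R z))" "integrable lborel (\<lambda>z. H z * f' (s *\<^sub>R z))"
        by (auto intro!: lborel_integral_eq_integral_cbox(2)[of _ "-a" a] continuous_intros)
    qed
    have dh: "divergence (\<lambda>w. h w *\<^sub>R w) z = 2 * s\<^sup>2 * f (s *\<^sub>R z) + s\<^sup>2 * f' (s *\<^sub>R z)" for z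
    proof -
      have D: "(f has_derivative frechet_derivative f (at z)) (at z)" for z
        using C_k_Suc_D[OF test_function_C_k[OF t]] .
      have "((\<lambda>z. s *\<^sub>R z) has_derivative (\<lambda>h. s *\<^sub>R h)) (at z)" by (auto intro!: derivative_eq_intros)
      from has_derivative_compose[OF this D]
      have "((\<lambda>z. f (s *\<^sub>R z)) has_derivative (\<lambda>v. frechet_derivative f (at (s *\<^sub>R z)) (s *\<^sub>R v))) (at z)" .
      then have "(h has_derivative (\<lambda>v. s\<^sup>2 * frechet_derivative f (at (s *\<^sub>R z)) (s *\<^sub>R v))) (at z)"
        unfolding h_def by (rule has_derivative_mult_right)
      from divergence_scaleR_ident[OF this] show ?thesis by (simp add: h_def f'_def)
    qed
    have "dl H h = - (LINT z|lborel. (2 * s\<^sup>2) * (H z * f (s *\<^sub>R z)) + s\<^sup>2 * (H z * f' (s *\<^sub>R z)))"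
      unfolding dl_def dh by (simp add: algebra_simps)
    also have "\<dots> = - (2 * s\<^sup>2 * B s + s\<^sup>2 * D s)"
      using i by (simp add: B_def D_def)
    also have "\<dots> = - s * (2 * s * B s + s * D s)" by (simp add: power2_eq_square algebra_simps)
    finally have "s * \<bar>2 * s * B s + s * D s\<bar> = \<bar>dl H h\<bar>" using s by (simp add: abs_mult)
    also have "\<dots> \<le> C * L2_norm h" by (rule dl[OF th])
    also have "L2_norm h = s * L2_norm f"
      unfolding h_def L2_norm_cmult using L2_norm_scale[OF test_function_square_integrable[OF t] s] s
      by (simp add: power2_eq_square)
    finally have "s * \<bar>2 * s * B s + s * D s\<bar> \<le> s * (C * L2_norm f)" by (simp add: algebra_simps)
    then show ?thesis using s by simp
  qed
  define G where "G s = s\<^sup>2 * B s" for s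
  have "norm (G r - G 1) \<le> C * L2_norm f * norm (r - 1)"
  proof (rule field_differentiable_bound[where S="{r..1}" and f'="\<lambda>s. 2 * s * B s + s * D s"])
    show "(G has_real_derivative 2 * s * B s + s * D s) (at s within {r..1})" if "s \<in> {r..1}" for s
      unfolding G_def by (rule has_field_derivative_at_within[OF dG]) (use r that in auto)
    show "norm (2 * s * B s + s * D s) \<le> C * L2_norm f" if "s \<in> {r..1}" for s
      using le[of s] r that by simp
  qed (use r in auto)
  then show ?thesis using r by (simp add: G_def B_def algebra_simps)
qed

lemma integral_scale_swap:
  fixes H f :: "complex \<Rightarrow> real"
  assumes "continuous_on UNIV H" "continuous_on UNIV f" "0 < r"
  shows "(LINT z|lborel. H z * f (r *\<^sub>R z)) = (LINT z|lborel. H ((1/r) *\<^sub>R z) * f z) / r\<^sup>2"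
proof -
  note [continuous_intros] = continuous_on_compose2[OF assms(1)] continuous_on_compose2[OF assms(2)]
  have "(\<lambda>z. H ((1/r) *\<^sub>R z) * f z) \<in> borel_measurable borel"
    by (intro borel_measurable_continuous_onI continuous_intros) auto
  from integral_lborel_scale(1)[OF this assms(3)] show ?thesis using assms(3) by simp
qed

lemma L2_norm_scale_diff_le:
  assumes H: "continuous_on UNIV H" "square_integrable H" and C: "0 \<le> C"
    and dl: "\<And>\<phi>. test_function \<phi> \<Longrightarrow> \<bar>dl H \<phi>\<bar> \<le> C * L2_norm \<phi>"
    and r: "0 < r" "r < 1"
  shows "L2_norm (\<lambda>z. H ((1/r) *\<^sub>R z) - H z) \<le> (1 - r) * C"
proof (rule L2_norm_le_of_test_functions)
  note [continuous_intros] = continuous_on_compose2[OF H(1)]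
  show "continuous_on UNIV (\<lambda>z. H ((1/r) *\<^sub>R z) - H z)" by (intro continuous_intros) auto
  have sH: "square_integrable (\<lambda>z. H ((1/r) *\<^sub>R z))" using square_integrable_scale[OF H(2)] r by simp
  then show "square_integrable (\<lambda>z. H ((1/r) *\<^sub>R z) - H z)" by (intro square_integrable_diff H)
  show "0 \<le> (1 - r) * C" using r C by simp
  fix f assume t: "test_function f"
  note sf = test_function_square_integrable[OF t]
  have "(LINT z|lborel. (H ((1/r) *\<^sub>R z) - H z) * f z) = (LINT z|lborel. H ((1/r) *\<^sub>R z) * f z - H z * f z)"
    by (simp add: algebra_simps)
  also have "\<dots> = r\<^sup>2 * (LINT z|lborel. H z * f (r *\<^sub>R z)) - (LINT z|lborel. H z * f z)"
    using integral_scale_swap[OF H(1) test_function_continuous[OF t] r(1)] r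
    by (subst Bochner_Integration.integral_diff) (auto intro!: square_integrable_mult sH sf H)
  finally show "\<bar>LINT z|lborel. (H ((1/r) *\<^sub>R z) - H z) * f z\<bar> \<le> (1 - r) * C * L2_norm f"
    using abs_integral_scale_diff_le[OF H(1) C dl t r] by (simp add: mult.assoc)
qed

text \<open>Divided by \<open>k - 1\<close>, the two norms tend to those of \<open>dl H + 2 H\<close> and \<open>dl H\<close> as \<open>k\<close> tends to 1.\<close>

lemma L2_norm_scale_diff_eq:
  assumes H: "square_integrable H" and k: "0 < k"
  shows "L2_norm (\<lambda>z. k\<^sup>2 * H (k *\<^sub>R z) - H z) = k * L2_norm (\<lambda>z. H (k *\<^sub>R z) - H z)"
proof -
  note sH = square_integrable_scale[OF H k]
  let ?I = "LINT z|lborel. H (k *\<^sub>R z) * H z"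
  have "(L2_norm (\<lambda>z. k\<^sup>2 * H (k *\<^sub>R z) - H z))\<^sup>2 = (k\<^sup>2 * (L2_norm H / k))\<^sup>2 - 2 * (k\<^sup>2 * ?I) + (L2_norm H)\<^sup>2"
    using L2_norm_diff_power2[OF square_integrable_cmult[OF sH, of "k\<^sup>2"] H] 
    by (simp add: L2_norm_cmult L2_norm_scale[OF H k] mult.assoc)
  also have "\<dots> = k\<^sup>2 * ((L2_norm H / k)\<^sup>2 - 2 * ?I + (L2_norm H)\<^sup>2)"
    using k by (simp add: field_simps power2_eq_square)
  also have "\<dots> = (k * L2_norm (\<lambda>z. H (k *\<^sub>R z) - H z))\<^sup>2"
    using L2_norm_diff_power2[OF sH H] by (simp add: L2_norm_scale[OF H k] power_mult_distrib)
  finally show ?thesis using k by (simp add: power2_eq_iff_nonneg)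
qed

lemma abs_integral_radial_derivative_le:
  assumes H: "continuous_on UNIV H" "square_integrable H" and C: "0 \<le> C"
    and dl: "\<And>\<phi>. test_function \<phi> \<Longrightarrow> \<bar>dl H \<phi>\<bar> \<le> C * L2_norm \<phi>"
    and f: "continuous_on UNIV f" "continuous_on UNIV f'"
    and supp: "\<And>z. R \<le> norm z \<Longrightarrow> f z = 0" "\<And>z. R \<le> norm z \<Longrightarrow> f' z = 0"
    and d: "has_radial_derivative f f'"
  shows "\<bar>LINT z|lborel. H z * f' z\<bar> \<le> C * L2_norm f"
proof -
  define B where "B s = (LINT z|lborel. H z * f (s *\<^sub>R z))" for s
  have sf: "square_integrable f" by (rule square_integrable_compact_support[OF f(1) supp(1)])
  have le: "\<bar>B r - B 1\<bar> \<le> (1 - r) * (C * L2_norm f / r)" if r: "0 < r" "r < 1" for r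
  proof -
    define k where "k = 1 / r"
    have k: "0 < k" using r by (simp add: k_def)
    note sH = square_integrable_scale[OF H(2) k]
    have s: "square_integrable (\<lambda>z. k\<^sup>2 * H (k *\<^sub>R z) - H z)"
      by (intro square_integrable_diff square_integrable_cmult sH H)
    have "B r - B 1 = k\<^sup>2 * (LINT z|lborel. H (k *\<^sub>R z) * f z) - (LINT z|lborel. H z * f z)"
      using integral_scale_swap[OF H(1) f(1) r(1)] r by (simp add: B_def k_def power_divide)
    also have "\<dots> = (LINT z|lborel. k\<^sup>2 * (H (k *\<^sub>R z) * f z) - H z * f z)"
      by (subst Bochner_Integration.integral_diff) (auto intro!: square_integrable_mult sH sf H)
    also have "\<dots> = (LINT z|lborel. (k\<^sup>2 * H (k *\<^sub>R z) - H z) * f z)"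
      by (simp add: algebra_simps)
    finally have "\<bar>B r - B 1\<bar> \<le> L2_norm (\<lambda>z. k\<^sup>2 * H (k *\<^sub>R z) - H z) * L2_norm f"
      using Cauchy_Schwarz_L2[OF s sf] by simp
    also have "\<dots> = k * L2_norm (\<lambda>z. H (k *\<^sub>R z) - H z) * L2_norm f"
      by (simp add: L2_norm_scale_diff_eq[OF H(2) k])
    also have "\<dots> \<le> k * ((1 - r) * C) * L2_norm f"
      using L2_norm_scale_diff_le[OF H C dl r] k unfolding k_def
      by (intro mult_right_mono mult_left_mono) auto
    finally show ?thesis by (simp add: k_def)
  qed
  have "(B has_real_derivative (LINT z|lborel. H z * f' z)) (at 1)"
  proof -
    have "(B has_real_derivative (LINT z|lborel. H z * f' (1 *\<^sub>R z)) / 1) (at 1)"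
      unfolding B_def by (rule deriv_integral_scale[where R=R]) (use H f supp d in auto)
    then show ?thesis by simp
  qed
  then have "((\<lambda>r. (B r - B 1) / (r - 1)) \<longlongrightarrow> (LINT z|lborel. H z * f' z)) (at_left 1)"
    unfolding has_field_derivative_iff by (rule tendsto_within_subset) simp
  then have "((\<lambda>r. \<bar>(B r - B 1) / (r - 1)\<bar>) \<longlongrightarrow> \<bar>LINT z|lborel. H z * f' z\<bar>) (at_left 1)"
    by (rule tendsto_rabs)
  moreover have "((\<lambda>r. C * L2_norm f / r) \<longlongrightarrow> C * L2_norm f / 1) (at_left 1)"
    by (intro tendsto_intros) auto
  moreover have "\<forall>\<^sub>F r in at_left 1. \<bar>(B r - B 1) / (r - 1)\<bar> \<le> C * L2_norm f / r"
    using eventually_at_left_real[OF zero_less_one]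
  proof eventually_elim
    case (elim r)
    then show ?case using le[of r] by (simp add: field_simps abs_divide)
  qed
  ultimately have "\<bar>LINT z|lborel. H z * f' z\<bar> \<le> C * L2_norm f / 1"
    by (intro tendsto_le[rotated 1]) (auto simp: trivial_limit_at_left_real)
  then show ?thesis by simp
qed

section \<open>Gaussian integrals\<close>

lemma integrable_prod_mult:
  fixes f :: "'a \<Rightarrow> real" and g :: "'b \<Rightarrow> real"
  assumes "sigma_finite_measure M" "sigma_finite_measure N" "integrable M f" "integrable N g"
  shows "integrable (M \<Otimes>\<^sub>M N) (\<lambda>(x, y). f x * g y)"
proof -
  interpret pair_sigma_finite M N using assms by (simp add: pair_sigma_finite_def)
  have [measurable]: "f \<in> borel_measurable M" "g \<in> borel_measurable N" using assms by auto
  show ?thesis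
    by (rule Fubini_integrable) (use assms in \<open>auto simp: abs_mult\<close>)
qed

lemma lborel_complex_eq_distr:
  "(lborel :: complex measure) = distr (lborel \<Otimes>\<^sub>M lborel) borel (\<lambda>(x, y). Complex x y)"
proof (rule lborel_eqI)
  have m: "(\<lambda>(x, y). Complex x y) \<in> borel_measurable (lborel \<Otimes>\<^sub>M lborel)"
    unfolding lborel_prod by (auto intro!: borel_measurable_continuous_onI continuous_intros simp: split_beta Complex_eq)
  fix l u :: complex
  assume "\<And>b. b \<in> Basis \<Longrightarrow> l \<bullet> b \<le> u \<bullet> b"
  from this[of 1] this[of \<i>] have lu: "Re l \<le> Re u" "Im l \<le> Im u" by (auto simp: Basis_complex_def)
  have "(\<lambda>(x, y). Complex x y) -` box l u \<inter> space (lborel \<Otimes>\<^sub>M lborel) = {Re l<..<Re u} \<times> {Im l<..<Im u}"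
    by (auto simp: box_def Basis_complex_def space_pair_measure)
  then have "emeasure (distr (lborel \<Otimes>\<^sub>M lborel) borel (\<lambda>(x, y). Complex x y)) (box l u)
    = emeasure (lborel \<Otimes>\<^sub>M lborel) ({Re l<..<Re u} \<times> {Im l<..<Im u})"
    using m by (simp add: emeasure_distr)
  also have "\<dots> = ennreal (Re u - Re l) * ennreal (Im u - Im l)"
    using lu by (subst lborel.emeasure_pair_measure_Times) auto
  finally show "emeasure (distr (lborel \<Otimes>\<^sub>M lborel) borel (\<lambda>(x, y). Complex x y)) (box l u)
    = ennreal (\<Prod>b\<in>Basis. (u - l) \<bullet> b)"
    using lu by (simp add: Basis_complex_def ennreal_mult)
qed simp

lemma has_bochner_integral_Re_Im:
  assumes f: "has_bochner_integral lborel f a" and g: "has_bochner_integral lborel g b"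
  shows "has_bochner_integral lborel (\<lambda>z. f (Re z) * g (Im z)) (a * b :: real)"
proof -
  have [measurable]: "f \<in> borel_measurable borel" "g \<in> borel_measurable borel"
    using f g by (auto simp: has_bochner_integral_iff)
  have m [measurable]: "(\<lambda>(x, y). Complex x y) \<in> borel_measurable (lborel \<Otimes>\<^sub>M lborel)"
    unfolding lborel_prod by (auto intro!: borel_measurable_continuous_onI continuous_intros simp: split_beta Complex_eq)
  have i: "integrable (lborel \<Otimes>\<^sub>M lborel) (\<lambda>(x, y). f x * g y)"
    using f g by (intro integrable_prod_mult lborel.sigma_finite_measure_axioms) (auto simp: has_bochner_integral_iff)
  have eq: "(\<lambda>p. f (Re (case p of (x, y) \<Rightarrow> Complex x y)) * g (Im (case p of (x, y) \<Rightarrow> Complex x y))) = (\<lambda>(x, y). f x * g y)"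
    by auto
  have "integrable lborel (\<lambda>z. f (Re z) * g (Im z))"
    by (subst lborel_complex_eq_distr, subst integrable_distr_eq) (use i eq in auto)
  moreover have "(LINT z|lborel. f (Re z) * g (Im z)) = (LINT p|(lborel \<Otimes>\<^sub>M lborel). (case p of (x, y) \<Rightarrow> f x * g y))"
    by (subst lborel_complex_eq_distr, subst integral_distr) (use eq in auto)
  moreover have "\<dots> = (LINT x|lborel. LINT y|lborel. f x * g y)"
    using lborel_pair.integral_fst[OF i] by simp
  moreover have "\<dots> = a * b"
    using f g by (simp add: has_bochner_integral_iff)
  ultimately show ?thesis by (simp add: has_bochner_integral_iff)
qed

lemma gaussian_moments:
  assumes L: "0 < L"
  shows "has_bochner_integral lborel (\<lambda>x. exp (- L * x\<^sup>2)) (sqrt (pi / L))"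
    and "has_bochner_integral lborel (\<lambda>x. exp (- L * x\<^sup>2) * x) 0"
    and "has_bochner_integral lborel (\<lambda>x. exp (- L * x\<^sup>2) * x\<^sup>2) (sqrt (pi / L) / (2 * L))"
proof -
  define s where "s = 1 / sqrt (2 * L)"
  have s: "0 < s" "s\<^sup>2 = 1 / (2 * L)" using L by (auto simp: s_def power_divide)
  have n: "sqrt (pi / L) * normal_density 0 s x = exp (- L * x\<^sup>2)" for x
    using L by (simp add: normal_density_def s real_sqrt_divide)
  have "has_bochner_integral lborel (\<lambda>x. sqrt (pi / L) * (normal_density 0 s x * (x - 0) ^ (2 * 0)))
      (sqrt (pi / L) * (fact (2 * 0) / ((2 / s\<^sup>2)^0 * fact 0)))"
    by (rule has_bochner_integral_mult_right[OF normal_moment_even[OF s(1)]])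
  then show "has_bochner_integral lborel (\<lambda>x. exp (- L * x\<^sup>2)) (sqrt (pi / L))" by (simp add: n)
  have "has_bochner_integral lborel (\<lambda>x. sqrt (pi / L) * (normal_density 0 s x * (x - 0) ^ (2 * 0 + 1)))
      (sqrt (pi / L) * 0)"
    by (rule has_bochner_integral_mult_right[OF normal_moment_odd[OF s(1)]])
  then show "has_bochner_integral lborel (\<lambda>x. exp (- L * x\<^sup>2) * x) 0" by (simp add: n flip: mult.assoc)
  have "has_bochner_integral lborel (\<lambda>x. sqrt (pi / L) * (normal_density 0 s x * (x - 0) ^ (2 * 1)))
      (sqrt (pi / L) * (fact (2 * 1) / ((2 / s\<^sup>2)^1 * fact 1)))"
    by (rule has_bochner_integral_mult_right[OF normal_moment_even[OF s(1)]])
  then show "has_bochner_integral lborel (\<lambda>x. exp (- L * x\<^sup>2) * x\<^sup>2) (sqrt (pi / L) / (2 * L))"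
    using L by (simp add: n s(2) flip: mult.assoc)
qed

definition cross :: "complex \<Rightarrow> complex \<Rightarrow> real" where
  "cross a b = Re a * Im b - Im a * Re b"

lemma cross_add_left: "cross (a + b) c = cross a c + cross b c"
  by (simp add: cross_def algebra_simps)

lemma cross_scaleR_left: "cross (r *\<^sub>R a) c = r * cross a c"
  by (simp add: cross_def algebra_simps)

lemma abs_cross_le: "\<bar>cross a b\<bar> \<le> norm a * norm b"
proof -
  have "cross a b = Im (cnj a * b)" by (simp add: cross_def)
  then show ?thesis using abs_Im_le_cmod[of "cnj a * b"] by (simp add: norm_mult)
qed

lemma continuous_on_cross [continuous_intros]:
  "continuous_on A f \<Longrightarrow> continuous_on A g \<Longrightarrow> continuous_on A (\<lambda>x. cross (f x) (g x))"
  unfolding cross_def by (intro continuous_intros)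

lemma exp_norm_complex: "exp (- L * (norm z)\<^sup>2) = exp (- L * (Re z)\<^sup>2) * exp (- L * (Im z)\<^sup>2)"
  by (simp add: cmod_power2 algebra_simps flip: exp_add)

lemma gaussian_complex:
  assumes "0 < L"
  shows "has_bochner_integral lborel (\<lambda>z::complex. exp (- L * (norm z)\<^sup>2)) (pi / L)"
proof -
  have "sqrt (pi / L) * sqrt (pi / L) = pi / L" using assms by simp
  then show ?thesis
    using has_bochner_integral_Re_Im[OF gaussian_moments(1)[OF assms] gaussian_moments(1)[OF assms]]
    by (simp only: exp_norm_complex)
qed

lemma gaussian_cross_cross:
  assumes L: "0 < L"
  shows "has_bochner_integral lborel (\<lambda>z. exp (- L * (norm z)\<^sup>2) * ((cross z S + p) * (cross z T + q)))
    (pi / L * ((S \<bullet> T) / (2 * L) + p * q))"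
proof -
  note m = gaussian_moments[OF L]
  note h = has_bochner_integral_Re_Im
  have "has_bochner_integral lborel (\<lambda>z.
      (Im S * Im T) * ((exp (- L * (Re z)\<^sup>2) * (Re z)\<^sup>2) * exp (- L * (Im z)\<^sup>2))
    + (Re S * Re T) * (exp (- L * (Re z)\<^sup>2) * (exp (- L * (Im z)\<^sup>2) * (Im z)\<^sup>2))
    + (- Im S * Re T - Re S * Im T) * ((exp (- L * (Re z)\<^sup>2) * Re z) * (exp (- L * (Im z)\<^sup>2) * Im z))
    + (Im S * q + Im T * p) * ((exp (- L * (Re z)\<^sup>2) * Re z) * exp (- L * (Im z)\<^sup>2))
    + (- Re S * q - Re T * p) * (exp (- L * (Re z)\<^sup>2) * (exp (- L * (Im z)\<^sup>2) * Im z))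
    + (p * q) * (exp (- L * (Re z)\<^sup>2) * exp (- L * (Im z)\<^sup>2)))
   ((Im S * Im T) * (sqrt (pi / L) / (2 * L) * sqrt (pi / L))
    + (Re S * Re T) * (sqrt (pi / L) * (sqrt (pi / L) / (2 * L)))
    + (- Im S * Re T - Re S * Im T) * (0 * 0)
    + (Im S * q + Im T * p) * (0 * sqrt (pi / L))
    + (- Re S * q - Re T * p) * (sqrt (pi / L) * 0)
    + (p * q) * (sqrt (pi / L) * sqrt (pi / L)))"
    by (intro has_bochner_integral_add has_bochner_integral_mult_right
        h[OF m(3) m(1)] h[OF m(1) m(3)] h[OF m(2) m(2)] h[OF m(2) m(1)] h[OF m(1) m(2)] h[OF m(1) m(1)])
  moreover have "\<dots> = pi / L * ((S \<bullet> T) / (2 * L) + p * q)"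
  proof -
    have e: "sqrt (pi / L) * sqrt (pi / L) = pi / L" using L by simp
    then have e': "sqrt (pi / L) / (2 * L) * sqrt (pi / L) = pi / L / (2 * L)"
      "sqrt (pi / L) * (sqrt (pi / L) / (2 * L)) = pi / L / (2 * L)" by simp_all
    show ?thesis unfolding e e' by (simp add: inner_complex_def algebra_simps add_divide_distrib)
  qed
  moreover have "(\<lambda>z. exp (- L * (norm z)\<^sup>2) * ((cross z S + p) * (cross z T + q))) = (\<lambda>z.
      (Im S * Im T) * ((exp (- L * (Re z)\<^sup>2) * (Re z)\<^sup>2) * exp (- L * (Im z)\<^sup>2))
    + (Re S * Re T) * (exp (- L * (Re z)\<^sup>2) * (exp (- L * (Im z)\<^sup>2) * (Im z)\<^sup>2))
    + (- Im S * Re T - Re S * Im T) * ((exp (- L * (Re z)\<^sup>2) * Re z) * (exp (- L * (Im z)\<^sup>2) * Im z))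
    + (Im S * q + Im T * p) * ((exp (- L * (Re z)\<^sup>2) * Re z) * exp (- L * (Im z)\<^sup>2))
    + (- Re S * q - Re T * p) * (exp (- L * (Re z)\<^sup>2) * (exp (- L * (Im z)\<^sup>2) * Im z))
    + (p * q) * (exp (- L * (Re z)\<^sup>2) * exp (- L * (Im z)\<^sup>2)))"
    unfolding exp_norm_complex cross_def by (rule ext) (simp add: algebra_simps power2_eq_square)
  ultimately show ?thesis by (simp only:)
qed

lemma lborel_translate:
  fixes f :: "complex \<Rightarrow> real"
  assumes "f \<in> borel_measurable borel"
  shows "(LINT z|lborel. f (a + z)) = (LINT z|lborel. f z)"
proof -
  have "(LINT z|lborel. f z) = (LINT z|distr lborel borel ((+) a). f z)"
    by (simp add: lborel_distr_plus)
  also have "\<dots> = (LINT z|lborel. f (a + z))" using assms by (subst integral_distr) auto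
  finally show ?thesis by simp
qed

lemma gaussian_kernels_inner:
  assumes s: "0 < s" "0 < s'"
  defines "r \<equiv> s + s'"
  shows "(LINT z|lborel. (exp (- (norm (z - a))\<^sup>2 / s) * cross (z - a) S) * (exp (- (norm (z - b))\<^sup>2 / s') * cross (z - b) T))
    = pi * (s * s')\<^sup>2 / r\<^sup>2 * exp (- (norm (b - a))\<^sup>2 / r) * ((S \<bullet> T) / 2 - cross (b - a) S * cross (b - a) T / r)"
    (is "?lhs = ?rhs")
proof -
  define L where "L = 1 / s + 1 / s'"
  have r: "0 < r" using s by (simp add: r_def)
  have L: "0 < L" "L = r / (s * s')" using s by (simp_all add: L_def r_def field_simps add_pos_pos)
  define d where "d = b - a"
  define m where "m = a + (s / r) *\<^sub>R d"
  have rr: "s / r + s' / r = 1" using r by (simp add: r_def add_divide_distrib[symmetric])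
  have "d = (s / r + s' / r) *\<^sub>R d" by (simp only: rr scaleR_one)
  then have db: "(m + z) - a = z + (s / r) *\<^sub>R d" "(m + z) - b = z - (s' / r) *\<^sub>R d" for z
    by (simp_all add: m_def d_def algebra_simps)
  have ex: "- (norm (z + (s / r) *\<^sub>R d))\<^sup>2 / s + - (norm (z - (s' / r) *\<^sub>R d))\<^sup>2 / s' = - (norm d)\<^sup>2 / r + - L * (norm z)\<^sup>2" for z
  proof -
    have q: "- (x + s / r * y)\<^sup>2 / s + - (x - s' / r * y)\<^sup>2 / s' = - y\<^sup>2 / r + - L * x\<^sup>2" for x y :: real
    proof -
      define c where "c = s * s' / r"
      have c: "s' * (s / r) = c" "s * (s' / r) = c" "s' + s = r" by (simp_all add: c_def) (simp add: r_def)
      have "s' * (x + s / r * y)\<^sup>2 + s * (x - s' / r * y)\<^sup>2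
        = (s' + s) * x\<^sup>2 + 2 * (s' * (s / r) - s * (s' / r)) * x * y + (s' * (s / r) * (s / r) + s * (s' / r) * (s' / r)) * y\<^sup>2"
        unfolding power2_eq_square by algebra
      also have "\<dots> = r * x\<^sup>2 + c * (s / r + s' / r) * y\<^sup>2"
        unfolding c by algebra
      finally have e: "s' * (x + s / r * y)\<^sup>2 + s * (x - s' / r * y)\<^sup>2 = r * x\<^sup>2 + s * s' * y\<^sup>2 / r"
        unfolding rr by (simp add: c_def)
      have "- (x + s / r * y)\<^sup>2 / s + - (x - s' / r * y)\<^sup>2 / s' = - (s' * (x + s / r * y)\<^sup>2 + s * (x - s' / r * y)\<^sup>2) / (s * s')"
        using s by (simp add: field_simps)
      also have "\<dots> = - y\<^sup>2 / r + - L * x\<^sup>2" unfolding e L(2) using s by (simp add: field_simps)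
      finally show ?thesis .
    qed
    have "- (norm (z + (s / r) *\<^sub>R d))\<^sup>2 / s + - (norm (z - (s' / r) *\<^sub>R d))\<^sup>2 / s'
      = (- (Re z + s / r * Re d)\<^sup>2 / s + - (Re z - s' / r * Re d)\<^sup>2 / s') + (- (Im z + s / r * Im d)\<^sup>2 / s + - (Im z - s' / r * Im d)\<^sup>2 / s')"
      by (simp add: cmod_power2 diff_divide_distrib)
    also have "\<dots> = - (norm d)\<^sup>2 / r + - L * (norm z)\<^sup>2"
      unfolding q by (simp add: cmod_power2 algebra_simps add_divide_distrib diff_divide_distrib)
    finally show ?thesis .
  qed
  have arrange: "(e1 * x) * (e2 * y) = e * (g * (x * y'))" if "e1 * e2 = e * g" "y = y'" for e1 e2 e g x y y' :: real
  proof -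
    have "(e1 * x) * (e2 * y) = (e1 * e2) * (x * y)" by simp
    then show ?thesis unfolding that by simp
  qed
  have "?lhs = (LINT z|lborel. (exp (- (norm ((m + z) - a))\<^sup>2 / s) * cross ((m + z) - a) S) * (exp (- (norm ((m + z) - b))\<^sup>2 / s') * cross ((m + z) - b) T))"
    by (rule lborel_translate[symmetric]) (intro borel_measurable_continuous_onI continuous_intros; use s in simp)
  also have "\<dots> = (LINT z|lborel. exp (- (norm d)\<^sup>2 / r) * (exp (- L * (norm z)\<^sup>2) * ((cross z S + (s / r) * cross d S) * (cross z T + (- (s' / r) * cross d T)))))"
  proof (rule Bochner_Integration.integral_cong[OF refl])
    fix z
    have "exp (- (norm (z + (s / r) *\<^sub>R d))\<^sup>2 / s) * exp (- (norm (z - (s' / r) *\<^sub>R d))\<^sup>2 / s') = exp (- (norm d)\<^sup>2 / r) * exp (- L * (norm z)\<^sup>2)"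
      unfolding exp_add[symmetric] ex ..
    moreover have "cross (z - (s' / r) *\<^sub>R d) T = cross z T + (- (s' / r) * cross d T)"
      by (simp add: cross_def algebra_simps)
    ultimately show "(exp (- (norm ((m + z) - a))\<^sup>2 / s) * cross ((m + z) - a) S) * (exp (- (norm ((m + z) - b))\<^sup>2 / s') * cross ((m + z) - b) T)
      = exp (- (norm d)\<^sup>2 / r) * (exp (- L * (norm z)\<^sup>2) * ((cross z S + (s / r) * cross d S) * (cross z T + (- (s' / r) * cross d T))))"
      unfolding db cross_add_left[of z] cross_scaleR_left by (rule arrange)
  qed
  also have "\<dots> = exp (- (norm d)\<^sup>2 / r) * (pi / L * ((S \<bullet> T) / (2 * L) + (s / r * cross d S) * (- (s' / r) * cross d T)))"
    using gaussian_cross_cross[OF L(1), of S "s / r * cross d S" T "- (s' / r) * cross d T"]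
    by (simp only: integral_mult_right_zero has_bochner_integral_integral_eq)
  also have "\<dots> = ?rhs"
    unfolding L(2) d_def[symmetric] using s r by (simp add: field_simps power2_eq_square)
  finally show ?thesis .
qed

lemma integral_square_of_integral:
  fixes K :: "'a \<Rightarrow> 'b \<Rightarrow> real"
  assumes M: "sigma_finite_measure M" and N: "sigma_finite_measure N"
    and K [measurable]: "(\<lambda>(p, z). K p z) \<in> borel_measurable (M \<Otimes>\<^sub>M N)"
    and a: "integrable M a" and b [measurable]: "b \<in> borel_measurable N" "integrable N (\<lambda>z. (b z)\<^sup>2)"
    and le: "\<And>p z. \<bar>K p z\<bar> \<le> a p * b z" and b0: "\<And>z. 0 \<le> b z" and a0: "\<And>p. 0 \<le> a p"
  shows "integrable N (\<lambda>z. (LINT p|M. K p z)\<^sup>2)"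
    and "(LINT z|N. (LINT p|M. K p z)\<^sup>2) = (LINT p|M. LINT q|M. LINT z|N. K p z * K q z)"
proof -
  interpret M: sigma_finite_measure M by fact
  interpret N: sigma_finite_measure N by fact
  interpret P: pair_sigma_finite M N by unfold_locales
  have [measurable]: "a \<in> borel_measurable M" using a by auto
  define w where "w z = (LINT p|M. K p z)" for z
  have [measurable]: "w \<in> borel_measurable N"
    unfolding w_def by measurable
  define A where "A = (LINT p|M. a p)"
  have A0: "0 \<le> A" unfolding A_def by (rule integral_nonneg_AE) (simp add: a0)
  have iK: "integrable M (\<lambda>p. K p z)" if "z \<in> space N" for z
  proof (rule Bochner_Integration.integrable_bound)
    show "integrable M (\<lambda>p. a p * b z)" using a by simp
    show "AE p in M. norm (K p z) \<le> norm (a p * b z)" using le by (auto simp: abs_mult a0 b0)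
  qed (use that in measurable)
  have wle: "\<bar>w z\<bar> \<le> A * b z" if "z \<in> space N" for z
  proof -
    have "\<bar>w z\<bar> \<le> (LINT p|M. \<bar>K p z\<bar>)" unfolding w_def by (rule integral_abs_bound)
    also have "\<dots> \<le> (LINT p|M. a p * b z)"
      by (intro integral_mono integrable_abs iK that) (use a le in auto)
    finally show ?thesis by (simp add: A_def)
  qed
  show "integrable N (\<lambda>z. (LINT p|M. K p z)\<^sup>2)"
    unfolding w_def[symmetric]
  proof (rule Bochner_Integration.integrable_bound)
    show "integrable N (\<lambda>z. A\<^sup>2 * (b z)\<^sup>2)" using b by simp
    have "(w z)\<^sup>2 \<le> A\<^sup>2 * (b z)\<^sup>2" if "z \<in> space N" for z
    proof -
      have "\<bar>w z\<bar>\<^sup>2 \<le> (A * b z)\<^sup>2" by (intro power_mono wle that) simp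
      then show ?thesis by (simp add: power_mult_distrib)
    qed
    then show "AE z in N. norm ((w z)\<^sup>2) \<le> norm (A\<^sup>2 * (b z)\<^sup>2)" by (auto intro!: AE_I2)
  qed simp
  have "(LINT z|N. (LINT p|M. K p z)\<^sup>2) = (LINT z|N. LINT p|M. K p z * w z)"
    unfolding w_def[symmetric] by (intro Bochner_Integration.integral_cong) (auto simp: w_def power2_eq_square)
  also have "\<dots> = (LINT p|M. LINT z|N. K p z * w z)"
  proof (rule P.Fubini_integral, rule Bochner_Integration.integrable_bound)
    show "integrable (M \<Otimes>\<^sub>M N) (\<lambda>(p, z). (A * a p) * (b z)\<^sup>2)"
      using a b by (intro integrable_prod_mult M N) auto
    have "\<bar>K p z * w z\<bar> \<le> \<bar>A * a p * (b z)\<^sup>2\<bar>" if "z \<in> space N" for p z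
    proof -
      have "\<bar>K p z * w z\<bar> \<le> (a p * b z) * (A * b z)"
        unfolding abs_mult by (intro mult_mono le wle that) (auto simp: a0 b0)
      then show ?thesis by (simp add: abs_mult A0 a0 b0 power2_eq_square mult_ac)
    qed
    then show "AE x in M \<Otimes>\<^sub>M N. norm (case x of (p, z) \<Rightarrow> K p z * w z) \<le> norm (case x of (p, z) \<Rightarrow> (A * a p) * (b z)\<^sup>2)"
      by (auto intro!: AE_I2 simp: space_pair_measure)
  qed measurable
  also have "\<dots> = (LINT p|M. LINT q|M. LINT z|N. K p z * K q z)"
  proof (rule Bochner_Integration.integral_cong[OF refl])
    fix p assume p: "p \<in> space M"
    have "(LINT z|N. K p z * w z) = (LINT z|N. LINT q|M. K p z * K q z)"
      unfolding w_def by simp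
    also have "\<dots> = (LINT q|M. LINT z|N. K p z * K q z)"
    proof (rule P.Fubini_integral, rule Bochner_Integration.integrable_bound)
      show "integrable (M \<Otimes>\<^sub>M N) (\<lambda>(q, z). (a p * a q) * (b z)\<^sup>2)"
        using a b by (intro integrable_prod_mult M N) auto
      have "\<bar>K p z * K q z\<bar> \<le> \<bar>a p * a q * (b z)\<^sup>2\<bar>" for q z
      proof -
        have "\<bar>K p z * K q z\<bar> \<le> (a p * b z) * (a q * b z)"
          unfolding abs_mult by (intro mult_mono le) (auto simp: a0 b0)
        then show ?thesis by (simp add: abs_mult a0 b0 power2_eq_square mult_ac)
      qed
      then show "AE x in M \<Otimes>\<^sub>M N. norm (case x of (q, z) \<Rightarrow> K p z * K q z) \<le> norm (case x of (q, z) \<Rightarrow> (a p * a q) * (b z)\<^sup>2)"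
        by (auto intro!: AE_I2)
    qed (use p in measurable)
    finally show "(LINT z|N. K p z * w z) = (LINT q|M. LINT z|N. K p z * K q z)" .
  qed
  finally show "(LINT z|N. (LINT p|M. K p z)\<^sup>2) = (LINT p|M. LINT q|M. LINT z|N. K p z * K q z)" .
qed

section \<open>The regularised winding number\<close>

lemma lborel_integral_indicator_cbox:
  fixes f :: "'a::euclidean_space \<Rightarrow> real"
  assumes "continuous_on (cbox a b) f"
  shows "(LINT x|lborel. indicat_real (cbox a b) x * f x) = integral (cbox a b) f"
proof -
  have "set_integrable lborel (cbox a b) f"
    unfolding set_integrable_def using borel_integrable_compact[OF compact_cbox assms] by simp
  from set_borel_integral_eq_integral(2)[OF this] show ?thesis
    by (simp add: set_lebesgue_integral_def)
qed

lemma integral_Pair_iterated: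
  fixes f :: "real \<Rightarrow> real \<Rightarrow> real"
  assumes "continuous_on (cbox (a, c) (b, d)) (\<lambda>(x, y). f x y)"
  shows "integral (cbox (a, c) (b, d)) (\<lambda>(x, y). f x y) = integral {a..b} (\<lambda>x. integral {c..d} (f x))"
    and "integral (cbox (a, c) (b, d)) (\<lambda>(x, y). f x y) = integral {c..d} (\<lambda>y. integral {a..b} (\<lambda>x. f x y))"
  using integral_prod_continuous[OF assms] integral_swap_continuous[OF assms] by simp_all

lemma continuous_on_real_integral:
  fixes f :: "'a::topological_space \<Rightarrow> real \<Rightarrow> real"
  assumes "continuous_on (U \<times> {a..b}) (\<lambda>(x, t). f x t)"
  shows "continuous_on U (\<lambda>x. integral {a..b} (f x))"
  using integral_continuous_on_param[of U a b f] assms by simp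

text \<open>With \<open>E r = r / D * exp (- D / r)\<close> the integrand is \<open>E'' (s + s')\<close>.\<close>

lemma heat_mass_le_1:
  fixes D a b :: real
  assumes D: "0 \<le> D" and ab: "0 < a" "a \<le> b"
  shows "integral {a..b} (\<lambda>s. integral {a..b} (\<lambda>s'. D / (s + s') ^ 3 * exp (- D / (s + s')))) \<le> 1"
proof (cases "D = 0")
  case True then show ?thesis by simp
next
  case False
  then have D: "0 < D" using D by simp
  define G where "G r = (1 / D + 1 / r) * exp (- D / r)" for r
  define E where "E r = r / D * exp (- D / r)" for r
  have dG: "(G has_real_derivative D / r ^ 3 * exp (- D / r)) (at r)" if "0 < r" for r
    unfolding G_def using that D
    by (auto intro!: derivative_eq_intros simp: field_simps power2_eq_square power3_eq_cube)
  have dE: "(E has_real_derivative G r) (at r)" if "0 < r" for r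
    unfolding E_def G_def using that D
    by (auto intro!: derivative_eq_intros simp: field_simps power2_eq_square)
  have inner: "integral {a..b} (\<lambda>s'. D / (s + s') ^ 3 * exp (- D / (s + s'))) = G (s + b) - G (s + a)" if "a \<le> s" for s
  proof (rule integral_unique, rule fundamental_theorem_of_calculus[OF ab(2)])
    fix x assume "x \<in> {a..b}"
    then have "0 < s + x" using that ab by simp
    moreover have "((\<lambda>x. s + x) has_real_derivative 1) (at x)" by (auto intro!: derivative_eq_intros)
    ultimately
    have "((\<lambda>x. G (s + x)) has_real_derivative D / (s + x) ^ 3 * exp (- D / (s + x))) (at x)"
      using DERIV_chain2[where f=G and g="\<lambda>x. s + x" and x=x and s=UNIV, OF dG] by fastforce
    then show "((\<lambda>x. G (s + x)) has_vector_derivative D / (s + x) ^ 3 * exp (- D / (s + x))) (at x within {a..b})"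
      by (simp add: has_real_derivative_iff_has_vector_derivative has_vector_derivative_at_within)
  qed
  have Gle: "G r \<le> 1 / D" if "0 < r" for r
  proof -
    have "(1 + D / r) * exp (- (D / r)) \<le> exp (D / r) * exp (- (D / r))"
      by (intro mult_right_mono exp_ge_add_one_self) simp
    then have "(1 + D / r) * exp (- (D / r)) \<le> 1" by (simp add: mult_exp_exp)
    then have "(1 / D) * ((1 + D / r) * exp (- (D / r))) \<le> (1 / D) * 1"
      using D by (intro mult_left_mono) auto
    moreover have "G r = (1 / D) * ((1 + D / r) * exp (- (D / r)))"
      using D that by (simp add: G_def field_simps)
    ultimately show ?thesis by simp
  qed
  have iG: "((\<lambda>s. G (s + a)) has_integral E (b + a) - E (a + a)) {a..b}"
  proof (rule fundamental_theorem_of_calculus[OF ab(2)])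
    fix x assume "x \<in> {a..b}"
    then have "0 < x + a" using ab by simp
    moreover have "((\<lambda>x. x + a) has_real_derivative 1) (at x)" by (auto intro!: derivative_eq_intros)
    ultimately
    have "((\<lambda>x. E (x + a)) has_real_derivative G (x + a)) (at x)"
      using DERIV_chain2[where f=E and g="\<lambda>x. x + a" and x=x and s=UNIV, OF dE] by fastforce
    then show "((\<lambda>x. E (x + a)) has_vector_derivative G (x + a)) (at x within {a..b})"
      by (simp add: has_real_derivative_iff_has_vector_derivative has_vector_derivative_at_within)
  qed
  have cG: "continuous_on {0<..} G" using dG
    by (intro continuous_at_imp_continuous_on) (auto intro: DERIV_isCont)
  have "integral {a..b} (\<lambda>s. integral {a..b} (\<lambda>s'. D / (s + s') ^ 3 * exp (- D / (s + s'))))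
      = integral {a..b} (\<lambda>s. G (s + b) - G (s + a))"
    by (intro integral_cong) (use inner in auto)
  also have "\<dots> \<le> integral {a..b} (\<lambda>s. 1 / D - G (s + a))"
    by (intro integral_le integrable_continuous_real continuous_intros continuous_on_compose2[OF cG])
      (use ab Gle in auto)
  also have "\<dots> = (b - a) / D - (E (b + a) - E (a + a))"
    using ab has_integral_diff[OF has_integral_const_real[of "1 / D" a b] iG] by (simp add: integral_unique)
  also have "\<dots> \<le> 1"
  proof -
    have "1 + - D / (b + a) \<le> exp (- D / (b + a))" by (rule exp_ge_add_one_self)
    then have "(b + a) / D * (1 + - D / (b + a)) \<le> E (b + a)"
      unfolding E_def using D ab by (intro mult_left_mono) auto
    moreover have "x / D * (1 + - D / x) = x / D - 1" if "0 < x" for x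
      using D that by (simp add: field_simps)
    from this[of "b + a"] have "(b + a) / D * (1 + - D / (b + a)) = (b + a) / D - 1"
      using ab by simp
    moreover have "E (a + a) \<le> (a + a) / D * 1"
      unfolding E_def using D ab by (intro mult_left_mono) auto
    ultimately show ?thesis by (simp add: add_divide_distrib diff_divide_distrib)
  qed
  finally show ?thesis .
qed

text \<open>The left-hand side is \<open>\<bar>d\<bar>\<^sup>2\<close> times the inner product of \<open>S\<close> with the reflection of \<open>T\<close> in the line
  through \<open>d\<close>.\<close>

lemma reflection_le:
  fixes d S T :: complex
  shows "2 * (d \<bullet> S) * (d \<bullet> T) - (norm d)\<^sup>2 * (S \<bullet> T) \<le> (norm d)\<^sup>2 * (norm S * norm T)"
proof -
  have "2 * (d \<bullet> S) * (d \<bullet> T) - (norm d)\<^sup>2 * (S \<bullet> T) = Re ((cnj d)\<^sup>2 * S * T)"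
    by (simp add: inner_complex_def cmod_power2) (simp add: power2_eq_square algebra_simps)
  also have "\<dots> \<le> norm ((cnj d)\<^sup>2 * S * T)" by (rule complex_Re_le_cmod)
  finally show ?thesis by (simp add: norm_mult norm_power)
qed

locale closed_curve =
  fixes u u' :: "real \<Rightarrow> complex" and c :: real
  assumes deriv: "\<And>t. (u has_vector_derivative u' t) (at t)"
    and cont_deriv: "continuous_on UNIV u'"
    and closed: "u (2 * pi) = u 0"
    and speed: "\<And>t. norm (u' t) \<le> c"
begin

lemma cont: "continuous_on UNIV u"
  using deriv by (intro continuous_at_imp_continuous_on) (auto intro: has_vector_derivative_continuous)

lemma continuous_on_u [continuous_intros]: "continuous_on A f \<Longrightarrow> continuous_on A (\<lambda>x. u (f x))"
  by (rule continuous_on_compose2[OF cont]) auto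

lemma continuous_on_u' [continuous_intros]: "continuous_on A f \<Longrightarrow> continuous_on A (\<lambda>x. u' (f x))"
  by (rule continuous_on_compose2[OF cont_deriv]) auto

lemma c_nonneg: "0 \<le> c"
  using order_trans[OF norm_ge_zero speed] .

text \<open>Integrated over all positive \<open>s\<close> this gives the kernel \<open>cross (z - u t) (u' t) / (2 \<pi> \<bar>z - u t\<bar>\<^sup>2)\<close>
  of the winding number.\<close>

definition kern :: "complex \<Rightarrow> real \<times> real \<Rightarrow> real" where
  "kern z = (\<lambda>(t, s). exp (- (norm (z - u t))\<^sup>2 / s) * cross (z - u t) (u' t) / (2 * pi * s\<^sup>2))"

definition winding :: "real \<Rightarrow> real \<Rightarrow> complex \<Rightarrow> real" where
  "winding a b z = integral (cbox (0, a) (2 * pi, b)) (kern z)"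

definition kern_inner :: "real \<Rightarrow> real \<Rightarrow> real \<Rightarrow> real" where
  "kern_inner t s r = exp (- (norm (u s - u t))\<^sup>2 / r) *
     ((u' t \<bullet> u' s) / 2 - cross (u s - u t) (u' t) * cross (u s - u t) (u' s) / r) / (4 * pi * r\<^sup>2)"

lemma integral_kern_kern:
  assumes "0 < r" "0 < r'"
  shows "(LINT z|lborel. kern z (t, r) * kern z (s, r')) = kern_inner t s (r + r')"
proof -
  have "(LINT z|lborel. kern z (t, r) * kern z (s, r')) = (LINT z|lborel. (1 / (4 * pi\<^sup>2 * (r * r')\<^sup>2)) *
    ((exp (- (norm (z - u t))\<^sup>2 / r) * cross (z - u t) (u' t)) * (exp (- (norm (z - u s))\<^sup>2 / r') * cross (z - u s) (u' s))))"
    by (intro Bochner_Integration.integral_cong) (simp_all add: kern_def power2_eq_square)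
  also have "\<dots> = kern_inner t s (r + r')"
    unfolding integral_mult_right_zero gaussian_kernels_inner[OF assms] kern_inner_def
    using assms by (simp add: power2_eq_square)
  finally show ?thesis .
qed

text \<open>The derivative of \<open>exp (- \<bar>u s - u t\<bar>\<^sup>2 / r) * ((u s - u t) \<bullet> u' t)\<close> in \<open>s\<close>.\<close>

definition boundary :: "real \<Rightarrow> real \<Rightarrow> real \<Rightarrow> real" where
  "boundary t s r = exp (- (norm (u s - u t))\<^sup>2 / r) *
     (u' t \<bullet> u' s - 2 / r * ((u s - u t) \<bullet> u' t) * ((u s - u t) \<bullet> u' s))"

lemma cross_mult_cross: "cross d S * cross d T = (norm d)\<^sup>2 * (S \<bullet> T) - (d \<bullet> S) * (d \<bullet> T)"
  by (simp add: cross_def inner_complex_def cmod_power2) (simp add: power2_eq_square algebra_simps)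

lemma kern_inner_le:
  assumes r: "0 < r"
  shows "kern_inner t s r \<le> c\<^sup>2 / (4 * pi) * ((norm (u s - u t))\<^sup>2 / r ^ 3 * exp (- (norm (u s - u t))\<^sup>2 / r))
    + 1 / (8 * pi * r\<^sup>2) * boundary t s r"
proof -
  define d where "d = u s - u t"
  define e where "e = exp (- (norm d)\<^sup>2 / r)"
  have "2 * (d \<bullet> u' t) * (d \<bullet> u' s) - (norm d)\<^sup>2 * (u' t \<bullet> u' s) \<le> (norm d)\<^sup>2 * (norm (u' t) * norm (u' s))"
    by (rule reflection_le)
  also have "\<dots> \<le> (norm d)\<^sup>2 * (c * c)"
    by (intro mult_left_mono mult_mono speed c_nonneg) auto
  finally have le: "2 * (d \<bullet> u' t) * (d \<bullet> u' s) - (norm d)\<^sup>2 * (u' t \<bullet> u' s) \<le> (norm d)\<^sup>2 * c\<^sup>2"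
    by (simp add: power2_eq_square)
  have "kern_inner t s r = 1 / (4 * pi * r ^ 3) * e * (2 * (d \<bullet> u' t) * (d \<bullet> u' s) - (norm d)\<^sup>2 * (u' t \<bullet> u' s))
    + 1 / (8 * pi * r\<^sup>2) * boundary t s r"
    unfolding kern_inner_def boundary_def d_def[symmetric] e_def[symmetric] cross_mult_cross
    using r by (simp add: field_simps power2_eq_square power3_eq_cube)
  also have "\<dots> \<le> 1 / (4 * pi * r ^ 3) * e * ((norm d)\<^sup>2 * c\<^sup>2) + 1 / (8 * pi * r\<^sup>2) * boundary t s r"
    using r by (intro add_right_mono mult_left_mono le) (auto simp: e_def)
  also have "1 / (4 * pi * r ^ 3) * e * ((norm d)\<^sup>2 * c\<^sup>2) = c\<^sup>2 / (4 * pi) * ((norm d)\<^sup>2 / r ^ 3 * e)"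
    by simp
  finally show ?thesis by (simp add: d_def e_def)
qed

lemma integral_boundary: "integral {0..2 * pi} (\<lambda>s. boundary t s r) = 0"
proof -
  define F where "F s = exp (- ((u s - u t) \<bullet> (u s - u t)) / r) * ((u s - u t) \<bullet> u' t)" for s
  have "((\<lambda>s. boundary t s r) has_integral F (2 * pi) - F 0) {0..2 * pi}"
  proof (rule fundamental_theorem_of_calculus)
    fix s assume "s \<in> {0..2 * pi}"
    have u: "(u has_derivative (\<lambda>h. h *\<^sub>R u' s)) (at s)"
      using deriv[of s] by (simp add: has_vector_derivative_def)
    have "(F has_derivative (\<lambda>h. h * boundary t s r)) (at s)"
      unfolding F_def boundary_def power2_norm_eq_inner
      by (auto intro!: derivative_eq_intros u simp: divide_inverse)
        (simp add: fun_eq_iff algebra_simps inner_commute)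
    then have "(F has_real_derivative boundary t s r) (at s)"
      by (simp add: has_field_derivative_def mult_commute_abs)
    then show "(F has_vector_derivative boundary t s r) (at s within {0..2 * pi})"
      by (simp add: has_real_derivative_iff_has_vector_derivative has_vector_derivative_at_within)
  qed simp
  moreover have "F (2 * pi) = F 0" by (simp add: F_def closed)
  ultimately show ?thesis by (simp add: integral_unique)
qed

lemma continuous_on_kern:
  assumes "0 < a"
  shows "continuous_on (UNIV \<times> cbox (0, a) (2 * pi, b)) (\<lambda>(z, p). kern z p)"
    and "continuous_on (cbox (0, a) (2 * pi, b)) (kern z)"
  using assms unfolding kern_def by (auto intro!: continuous_intros simp: split_beta cbox_Pair_eq)

lemma winding_eq_lborel:
  assumes "0 < a"
  shows "winding a b z = (LINT p|lborel. indicat_real (cbox (0, a) (2 * pi, b)) p * kern z p)"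
  unfolding winding_def lborel_integral_indicator_cbox[OF continuous_on_kern(2)[OF assms]] ..

lemma continuous_on_winding: "0 < a \<Longrightarrow> continuous_on UNIV (winding a b)"
  unfolding winding_def by (rule integral_continuous_on_param[OF continuous_on_kern(1)])

lemma kern_bound:
  assumes a: "0 < a"
  obtains C where "0 \<le> C" "\<And>z p. p \<in> cbox (0, a) (2 * pi, b) \<Longrightarrow> \<bar>kern z p\<bar> \<le> C * exp (- (norm z)\<^sup>2 / (4 * b))"
proof -
  have "compact (u ` {0..2 * pi})" by (intro compact_continuous_image continuous_intros) auto
  then obtain U where U: "\<And>t. t \<in> {0..2 * pi} \<Longrightarrow> norm (u t) \<le> U"
    using bounded_iff compact_imp_bounded by (metis imageI)
  define C where "C = (1 + b / 2) * exp (U\<^sup>2 / (2 * b)) * c / (2 * pi * a\<^sup>2)"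
  have "\<bar>kern z p\<bar> \<le> \<bar>C\<bar> * exp (- (norm z)\<^sup>2 / (4 * b))" if p: "p \<in> cbox (0, a) (2 * pi, b)" for z p
  proof -
    obtain t s where ts: "p = (t, s)" "t \<in> {0..2 * pi}" "a \<le> s" "s \<le> b" using p by (cases p) (auto simp: cbox_Pair_eq)
    define y where "y = norm (z - u t)"
    have y0: "0 \<le> y" by (simp add: y_def)
    have s: "0 < s" "0 < b" using ts a by auto
    have 1: "exp (- y\<^sup>2 / s) \<le> exp (- y\<^sup>2 / b)" using s ts by (simp add: frac_le)
    have "y \<le> (1 + b / 2) * (1 + y\<^sup>2 / (2 * b))"
    proof -
      have "0 \<le> (y - b)\<^sup>2 / (2 * b)" using s by simp
      then have "y \<le> y\<^sup>2 / (2 * b) + b / 2" using s by (simp add: power2_diff field_simps power2_eq_square)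
      moreover have "(1 + b / 2) * (1 + y\<^sup>2 / (2 * b)) = 1 + y\<^sup>2 / (2 * b) + b / 2 + y\<^sup>2 / 4"
        using s by (simp add: field_simps)
      moreover have "0 \<le> y\<^sup>2 / 4" by simp
      ultimately show ?thesis by linarith
    qed
    also have "\<dots> \<le> (1 + b / 2) * exp (y\<^sup>2 / (2 * b))"
      using s by (intro mult_left_mono exp_ge_add_one_self) auto
    finally have 2: "y \<le> (1 + b / 2) * exp (y\<^sup>2 / (2 * b))" .
    have 3: "- y\<^sup>2 / (2 * b) \<le> U\<^sup>2 / (2 * b) + - (norm z)\<^sup>2 / (4 * b)"
    proof -
      have "norm z \<le> y + U" using norm_triangle_ineq[of "z - u t" "u t"] U[OF ts(2)] by (simp add: y_def)
      then have "(norm z)\<^sup>2 \<le> (y + U)\<^sup>2" by (intro power_mono) auto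
      also have "\<dots> \<le> 2 * y\<^sup>2 + 2 * U\<^sup>2" using zero_le_power2[of "y - U"] unfolding power2_diff power2_sum by linarith
      finally have "(norm z)\<^sup>2 \<le> 2 * y\<^sup>2 + 2 * U\<^sup>2" .
      then have "(norm z)\<^sup>2 / (4 * b) \<le> (2 * y\<^sup>2 + 2 * U\<^sup>2) / (4 * b)" using s by (intro divide_right_mono) auto
      then show ?thesis using s by (simp add: add_divide_distrib)
    qed
    have "\<bar>kern z p\<bar> = exp (- y\<^sup>2 / s) * \<bar>cross (z - u t) (u' t)\<bar> / (2 * pi * s\<^sup>2)"
      by (simp add: kern_def ts y_def abs_mult abs_divide)
    also have "\<dots> \<le> exp (- y\<^sup>2 / b) * (y * c) / (2 * pi * a\<^sup>2)"
      using ts a abs_cross_le[of "z - u t" "u' t"] speed[of t] c_nonneg y0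
      by (intro frac_le mult_mono 1 power_mono order_trans[OF abs_cross_le]) (auto simp: y_def intro!: mult_left_mono)
    also have "\<dots> \<le> exp (- y\<^sup>2 / b) * (((1 + b / 2) * exp (y\<^sup>2 / (2 * b))) * c) / (2 * pi * a\<^sup>2)"
      by (intro divide_right_mono mult_left_mono mult_right_mono 2 c_nonneg) auto
    also have "\<dots> = (exp (- y\<^sup>2 / b) * exp (y\<^sup>2 / (2 * b))) * ((1 + b / 2) * c / (2 * pi * a\<^sup>2))" by simp
    also have "exp (- y\<^sup>2 / b) * exp (y\<^sup>2 / (2 * b)) = exp (- y\<^sup>2 / (2 * b))"
      using s by (simp add: mult_exp_exp field_simps)
    also have "exp (- y\<^sup>2 / (2 * b)) * ((1 + b / 2) * c / (2 * pi * a\<^sup>2))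
      \<le> exp (U\<^sup>2 / (2 * b) + - (norm z)\<^sup>2 / (4 * b)) * ((1 + b / 2) * c / (2 * pi * a\<^sup>2))"
      using 3 s c_nonneg by (intro mult_right_mono) auto
    also have "\<dots> = C * exp (- (norm z)\<^sup>2 / (4 * b))"
      unfolding exp_add C_def by simp
    also have "\<dots> \<le> \<bar>C\<bar> * exp (- (norm z)\<^sup>2 / (4 * b))" by (intro mult_right_mono) auto
    finally show ?thesis .
  qed
  then show ?thesis by (intro that[of "\<bar>C\<bar>"]) auto
qed

lemma winding_square:
  assumes a: "0 < a" "a \<le> b"
  shows "square_integrable (winding a b)"
    and "(LINT z|lborel. (winding a b z)\<^sup>2) = (LINT p|lborel. LINT q|lborel. LINT z|lborel.
      (indicat_real (cbox (0, a) (2 * pi, b)) p * kern z p) * (indicat_real (cbox (0, a) (2 * pi, b)) q * kern z q))"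
proof -
  let ?Q = "cbox (0, a) (2 * pi, b)"
  have b: "0 < b" using a by simp
  obtain C where C: "0 \<le> C" "\<And>z p. p \<in> ?Q \<Longrightarrow> \<bar>kern z p\<bar> \<le> C * exp (- (norm z)\<^sup>2 / (4 * b))"
    using kern_bound[OF a(1)] by metis
  have cc: "continuous_on (?Q \<times> UNIV) (\<lambda>(p, z). kern z p)"
    using a unfolding kern_def by (auto intro!: continuous_intros simp: split_beta cbox_Pair_eq)
  have "(\<lambda>x. indicat_real (?Q \<times> UNIV) x *\<^sub>R (case x of (p, z) \<Rightarrow> kern z p)) \<in> borel_measurable borel"
    by (intro borel_measurable_continuous_on_indicator cc borel_closed closed_Times) auto
  moreover have "(\<lambda>x. indicat_real (?Q \<times> UNIV) x *\<^sub>R (case x of (p, z) \<Rightarrow> kern z p)) = (\<lambda>(p, z). indicat_real ?Q p * kern z p)"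
    by (auto simp: indicator_def)
  ultimately have m: "(\<lambda>(p, z). indicat_real ?Q p * kern z p) \<in> borel_measurable (lborel \<Otimes>\<^sub>M lborel)"
    by (simp add: lborel_prod)
  have ia: "integrable lborel (\<lambda>p. C * indicat_real ?Q p)"
    using emeasure_bounded_finite[OF bounded_cbox, of "(0, a)" "(2 * pi, b)"] by auto
  have eb: "(exp (- (norm z)\<^sup>2 / (4 * b)))\<^sup>2 = exp (- (1 / (2 * b)) * (norm z)\<^sup>2)" for z :: complex
    using b by (simp add: exp_double[symmetric] field_simps)
  have ib: "integrable lborel (\<lambda>z::complex. (exp (- (norm z)\<^sup>2 / (4 * b)))\<^sup>2)"
    unfolding eb using gaussian_complex[of "1 / (2 * b)"] b by (auto simp: has_bochner_integral_iff)
  have mb: "(\<lambda>z::complex. exp (- (norm z)\<^sup>2 / (4 * b))) \<in> borel_measurable lborel"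
    by simp
  have le: "\<bar>indicat_real ?Q p * kern z p\<bar> \<le> C * indicat_real ?Q p * exp (- (norm z)\<^sup>2 / (4 * b))" for p z
    using C(2)[of p z] by (cases "p \<in> ?Q") (auto simp: abs_mult)
  note sq = integral_square_of_integral[OF lborel.sigma_finite_measure_axioms lborel.sigma_finite_measure_axioms m ia mb ib le]
  note w = winding_eq_lborel[OF a(1), symmetric]
  show "(LINT z|lborel. (winding a b z)\<^sup>2) = (LINT p|lborel. LINT q|lborel. LINT z|lborel.
      (indicat_real ?Q p * kern z p) * (indicat_real ?Q q * kern z q))"
    using sq(2) C(1) unfolding w by simp
  have "integrable lborel (\<lambda>z. (winding a b z)\<^sup>2)"
    using sq(1) C(1) unfolding w by simp
  then show "square_integrable (winding a b)"
    using borel_measurable_continuous_onI[OF continuous_on_winding[OF a(1), of b]] by (simp add: square_integrable_def)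
qed

lemma winding_square_eq:
  assumes a: "0 < a" "a \<le> b"
  shows "(LINT z|lborel. (winding a b z)\<^sup>2) = integral (cbox (0, a) (2 * pi, b)) (\<lambda>(t, r).
    integral (cbox (0, a) (2 * pi, b)) (\<lambda>(s, r'). kern_inner t s (r + r')))"
proof -
  let ?Q = "cbox (0, a) (2 * pi, b)"
  have c1: "continuous_on (?Q \<times> ?Q) (\<lambda>(p, q). kern_inner (fst p) (fst q) (snd p + snd q))"
    using a unfolding kern_inner_def by (auto intro!: continuous_intros simp: split_beta cbox_Pair_eq)
  then have c2: "continuous_on ?Q (\<lambda>q. kern_inner (fst p) (fst q) (snd p + snd q))" if "p \<in> ?Q" for p
    using that by (auto intro!: continuous_on_compose2[OF c1, of _ "\<lambda>q. (p, q)", simplified split_beta fst_conv snd_conv] continuous_intros)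
  have c3: "continuous_on ?Q (\<lambda>p. integral ?Q (\<lambda>q. kern_inner (fst p) (fst q) (snd p + snd q)))"
    by (rule integral_continuous_on_param[OF c1])
  have "(LINT p|lborel. LINT q|lborel. LINT z|lborel. (indicat_real ?Q p * kern z p) * (indicat_real ?Q q * kern z q))
    = (LINT p|lborel. indicat_real ?Q p * integral ?Q (\<lambda>q. kern_inner (fst p) (fst q) (snd p + snd q)))"
  proof (rule Bochner_Integration.integral_cong[OF refl])
    fix p :: "real \<times> real"
    show "(LINT q|lborel. LINT z|lborel. (indicat_real ?Q p * kern z p) * (indicat_real ?Q q * kern z q))
      = indicat_real ?Q p * integral ?Q (\<lambda>q. kern_inner (fst p) (fst q) (snd p + snd q))"
    proof (cases "p \<in> ?Q")
      case True
      have "(LINT z|lborel. (indicat_real ?Q p * kern z p) * (indicat_real ?Q q * kern z q))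
        = indicat_real ?Q q * kern_inner (fst p) (fst q) (snd p + snd q)" for q
      proof (cases "q \<in> ?Q")
        case q: True
        have "0 < snd p" "0 < snd q" using a q True by (auto simp: cbox_Pair_eq mem_Times_iff)
        from integral_kern_kern[OF this, of "fst p" "fst q"] show ?thesis using q True by simp
      qed simp
      then show ?thesis
        using True lborel_integral_indicator_cbox[OF c2[OF True]] by simp
    qed simp
  qed
  also have "\<dots> = integral ?Q (\<lambda>p. integral ?Q (\<lambda>q. kern_inner (fst p) (fst q) (snd p + snd q)))"
    by (rule lborel_integral_indicator_cbox[OF c3])
  finally show ?thesis
    unfolding winding_square(2)[OF a] by (simp add: case_prod_unfold)
qed

lemma L2_norm_winding_le:
  assumes a: "0 < a" "a \<le> b"
  shows "L2_norm (winding a b) \<le> sqrt pi * c"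
proof -
  let ?Q = "cbox (0, a) (2 * pi, b)"
  define J where "J t s r r' = (norm (u s - u t))\<^sup>2 / (r + r') ^ 3 * exp (- (norm (u s - u t))\<^sup>2 / (r + r'))" for t s r r' :: real
  have cJ: "continuous_on ((UNIV \<times> UNIV \<times> {a..b}) \<times> {a..b}) (\<lambda>((t, s, r), r'). J t s r r')"
    using a unfolding J_def by (auto intro!: continuous_intros simp: split_beta)
  define V where "V t s r = integral {a..b} (J t s r)" for t s r
  have cV: "continuous_on (UNIV \<times> UNIV \<times> {a..b}) (\<lambda>(t, s, r). V t s r)"
  proof -
    have "continuous_on (UNIV \<times> UNIV \<times> {a..b}) (\<lambda>x. integral {a..b} ((\<lambda>(t, s, r). J t s r) x))"
      by (rule continuous_on_real_integral) (use cJ in \<open>simp add: split_beta\<close>)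
    then show ?thesis by (simp add: V_def case_prod_unfold)
  qed
  have cV': "continuous_on A (\<lambda>x. V (f x) (g x) (h x))"
    if "continuous_on A f" "continuous_on A g" "continuous_on A h" "\<And>x. x \<in> A \<Longrightarrow> h x \<in> {a..b}" for A :: "'z::topological_space set" and f g h
  proof -
    have "continuous_on A (\<lambda>x. (\<lambda>(t, s, r). V t s r) (f x, g x, h x))"
      by (rule continuous_on_compose2[OF cV]) (use that in \<open>auto intro!: continuous_intros\<close>)
    then show ?thesis by simp
  qed
  have inner: "integral ?Q (\<lambda>(s, r'). kern_inner t s (r + r')) \<le> c\<^sup>2 / (4 * pi) * integral {0..2 * pi} (\<lambda>s. V t s r)"
    if r: "r \<in> {a..b}" for t r
  proof -
    have c1: "continuous_on ?Q (\<lambda>(s, r'). kern_inner t s (r + r'))"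
      using a r unfolding kern_inner_def by (auto intro!: continuous_intros simp: split_beta cbox_Pair_eq)
    have c2: "continuous_on ?Q (\<lambda>(s, r'). J t s r r')"
      using a r unfolding J_def by (auto intro!: continuous_intros simp: split_beta cbox_Pair_eq)
    have c3: "continuous_on ?Q (\<lambda>(s, r'). 1 / (8 * pi * (r + r')\<^sup>2) * boundary t s (r + r'))"
      using a r unfolding boundary_def by (auto intro!: continuous_intros simp: split_beta cbox_Pair_eq)
    have "integral ?Q (\<lambda>(s, r'). kern_inner t s (r + r'))
      \<le> integral ?Q (\<lambda>p. c\<^sup>2 / (4 * pi) * (\<lambda>(s, r'). J t s r r') p + (\<lambda>(s, r'). 1 / (8 * pi * (r + r')\<^sup>2) * boundary t s (r + r')) p)"
    proof (intro integral_le integrable_continuous c1 continuous_on_add continuous_on_mult continuous_on_const c2 c3)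
      fix p assume "p \<in> ?Q"
      then show "(\<lambda>(s, r'). kern_inner t s (r + r')) p \<le> c\<^sup>2 / (4 * pi) * (\<lambda>(s, r'). J t s r r') p
         + (\<lambda>(s, r'). 1 / (8 * pi * (r + r')\<^sup>2) * boundary t s (r + r')) p"
        using kern_inner_le[of "r + snd p" t "fst p"] a r by (auto simp: J_def cbox_Pair_eq split_beta)
    qed
    also have "\<dots> = integral ?Q (\<lambda>p. c\<^sup>2 / (4 * pi) * (\<lambda>(s, r'). J t s r r') p) + integral ?Q (\<lambda>(s, r'). 1 / (8 * pi * (r + r')\<^sup>2) * boundary t s (r + r'))"
      by (intro Henstock_Kurzweil_Integration.integral_add integrable_continuous c2 c3 continuous_on_mult continuous_on_const)
    also have "integral ?Q (\<lambda>p. c\<^sup>2 / (4 * pi) * (\<lambda>(s, r'). J t s r r') p) = c\<^sup>2 / (4 * pi) * integral ?Q (\<lambda>(s, r'). J t s r r')"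
      by (rule integral_mult_right)
    also have "integral ?Q (\<lambda>(s, r'). 1 / (8 * pi * (r + r')\<^sup>2) * boundary t s (r + r'))
      = integral {a..b} (\<lambda>r'. integral {0..2 * pi} (\<lambda>s. 1 / (8 * pi * (r + r')\<^sup>2) * boundary t s (r + r')))"
      by (rule integral_Pair_iterated(2)[OF c3])
    also have "\<dots> = 0" by (simp add: integral_boundary del: times_divide_eq_left)
    also have "integral ?Q (\<lambda>(s, r'). J t s r r') = integral {0..2 * pi} (\<lambda>s. V t s r)"
      unfolding V_def by (rule integral_Pair_iterated(1)[OF c2])
    finally show ?thesis by simp
  qed
  have c4: "continuous_on ?Q (\<lambda>(t, r). integral ?Q (\<lambda>(s, r'). kern_inner t s (r + r')))"
  proof -
    have "continuous_on ?Q (\<lambda>p. integral ?Q ((\<lambda>(t, r). \<lambda>(s, r'). kern_inner t s (r + r')) p))"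
      by (rule integral_continuous_on_param)
        (use a in \<open>auto intro!: continuous_intros simp: kern_inner_def split_beta cbox_Pair_eq\<close>)
    then show ?thesis by (simp add: case_prod_unfold)
  qed
  have c5: "continuous_on ?Q (\<lambda>(t, r). integral {0..2 * pi} (\<lambda>s. V t s r))"
  proof -
    have "continuous_on ?Q (\<lambda>p. integral {0..2 * pi} ((\<lambda>(t, r) s. V t s r) p))"
      by (rule continuous_on_real_integral) (auto simp: split_beta cbox_Pair_eq intro!: cV' continuous_intros)
    then show ?thesis by (simp add: case_prod_unfold)
  qed
  have "integral ?Q (\<lambda>(t, r). integral {0..2 * pi} (\<lambda>s. V t s r))
    = integral {0..2 * pi} (\<lambda>t. integral {a..b} (\<lambda>r. integral {0..2 * pi} (\<lambda>s. V t s r)))"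
    by (rule integral_Pair_iterated(1)[OF c5])
  also have "\<dots> = integral {0..2 * pi} (\<lambda>t. integral {0..2 * pi} (\<lambda>s. integral {a..b} (\<lambda>r. V t s r)))"
  proof (rule integral_cong)
    fix t
    have "continuous_on (cbox (a, 0) (b, 2 * pi)) (\<lambda>(r, s). V t s r)"
      by (auto simp: split_beta cbox_Pair_eq intro!: cV' continuous_intros)
    from integral_swap_continuous[OF this]
    show "integral {a..b} (\<lambda>r. integral {0..2 * pi} (\<lambda>s. V t s r)) = integral {0..2 * pi} (\<lambda>s. integral {a..b} (\<lambda>r. V t s r))"
      by simp
  qed
  also have "\<dots> \<le> integral {0..2 * pi} (\<lambda>t. integral {0..2 * pi} (\<lambda>s. 1))"
  proof (intro integral_le integrable_continuous_real)
    have c6: "continuous_on UNIV (\<lambda>x. integral {a..b} ((\<lambda>(t, s) r. V t s r) x))"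
      by (rule continuous_on_real_integral) (auto simp: split_beta intro!: cV' continuous_intros)
    then have c7: "continuous_on A (\<lambda>x. integral {a..b} (V (f x) (g x)))"
      if "continuous_on A f" "continuous_on A g" for A :: "'z::topological_space set" and f g
    proof -
      have "continuous_on A (\<lambda>x. (\<lambda>x. integral {a..b} ((\<lambda>(t, s) r. V t s r) x)) (f x, g x))"
        by (rule continuous_on_compose2[OF c6]) (use that in \<open>auto intro!: continuous_intros\<close>)
      then show ?thesis by simp
    qed
    show "continuous_on {0..2 * pi} (\<lambda>s. integral {a..b} (V t s))" for t
      by (intro c7 continuous_intros)
    show "continuous_on {0..2 * pi} (\<lambda>t. integral {0..2 * pi} (\<lambda>s. integral {a..b} (V t s)))"
      by (rule continuous_on_real_integral) (auto simp: split_beta intro!: c7 continuous_intros)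
    show "integral {a..b} (V t s) \<le> 1" for t s
      unfolding V_def J_def by (rule heat_mass_le_1[OF _ a]) simp
  qed auto
  also have "\<dots> = (2 * pi)\<^sup>2" by (simp add: power2_eq_square)
  finally have Vle: "integral ?Q (\<lambda>(t, r). integral {0..2 * pi} (\<lambda>s. V t s r)) \<le> (2 * pi)\<^sup>2" .
  have "(LINT z|lborel. (winding a b z)\<^sup>2) \<le> integral ?Q (\<lambda>p. c\<^sup>2 / (4 * pi) * (\<lambda>(t, r). integral {0..2 * pi} (\<lambda>s. V t s r)) p)"
    unfolding winding_square_eq[OF a]
    by (intro integral_le integrable_continuous c4 continuous_on_mult continuous_on_const c5)
      (use inner in \<open>auto simp: cbox_Pair_eq\<close>)
  also have "\<dots> = c\<^sup>2 / (4 * pi) * integral ?Q (\<lambda>(t, r). integral {0..2 * pi} (\<lambda>s. V t s r))"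
    by (rule integral_mult_right)
  also have "\<dots> \<le> c\<^sup>2 / (4 * pi) * (2 * pi)\<^sup>2"
    by (rule mult_left_mono[OF Vle]) simp
  also have "\<dots> = pi * c\<^sup>2" by (simp add: power2_eq_square)
  finally have "sqrt (LINT z|lborel. (winding a b z)\<^sup>2) \<le> sqrt (pi * c\<^sup>2)" by (rule real_sqrt_le_mono)
  then show ?thesis using c_nonneg by (simp add: L2_norm_def real_sqrt_mult)
qed

end

section \<open>The radial derivative of the winding number\<close>

definition heat :: "real \<Rightarrow> complex \<Rightarrow> real" where
  "heat s z = exp (- (norm z)\<^sup>2 / s) / (pi * s)"

lemma heat_integral:
  assumes "0 < s"
  shows "has_bochner_integral lborel (heat s) 1"
  using has_bochner_integral_mult_right[OF gaussian_complex[of "1 / s"], of "1 / (pi * s)"] assms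
  by (simp add: heat_def[abs_def])

lemma heat_bounds: "0 < s \<Longrightarrow> 0 \<le> heat s z" "0 < s \<Longrightarrow> heat s z \<le> 1 / (pi * s)"
  by (simp_all add: heat_def divide_right_mono)

lemma continuous_on_heat [continuous_intros]:
  "continuous_on A f \<Longrightarrow> continuous_on A (\<lambda>x. heat s (f x))"
  unfolding heat_def divide_inverse by (intro continuous_intros)

lemma heat_approximate_identity:
  assumes f: "continuous_on UNIV f" "\<And>z. \<bar>f z\<bar> \<le> B"
  shows "(\<lambda>n. LINT z|lborel. f z * heat (1 / real (Suc n)) (z - x)) \<longlonglongrightarrow> f x"
proof -
  note [continuous_intros] = continuous_on_compose2[OF f(1)]
  have eq: "(LINT z|lborel. f z * heat (1 / real (Suc n)) (z - x)) = (LINT y|lborel. f (x + sqrt (1 / real (Suc n)) *\<^sub>R y) * heat 1 y)" for n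
  proof -
    define s where "s = sqrt (1 / real (Suc n))"
    have s: "0 < s" "s\<^sup>2 = 1 / real (Suc n)" by (simp_all add: s_def)
    have "(LINT z|lborel. f z * heat (s\<^sup>2) (z - x)) = (LINT z|lborel. f (x + z) * heat (s\<^sup>2) ((x + z) - x))"
      by (rule lborel_translate[symmetric]) (intro borel_measurable_continuous_onI continuous_intros; simp)
    also have "\<dots> = s\<^sup>2 * (LINT y|lborel. f (x + s *\<^sub>R y) * heat (s\<^sup>2) (s *\<^sub>R y))"
    proof -
      have "(\<lambda>z. f (x + z) * heat (s\<^sup>2) z) \<in> borel_measurable borel"
        by (intro borel_measurable_continuous_onI continuous_intros) simp
      from integral_lborel_scale(1)[OF this s(1)] show ?thesis using s(1) by simp
    qed
    also have "\<dots> = (LINT y|lborel. f (x + s *\<^sub>R y) * (s\<^sup>2 * heat (s\<^sup>2) (s *\<^sub>R y)))"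
      by (simp flip: integral_mult_right_zero add: mult_ac)
    also have "\<dots> = (LINT y|lborel. f (x + s *\<^sub>R y) * heat 1 y)"
    proof -
      have "s\<^sup>2 * heat (s\<^sup>2) (s *\<^sub>R y) = heat 1 y" for y
        using s(1) by (simp add: heat_def power_mult_distrib)
      then show ?thesis by (simp only:)
    qed
    finally show ?thesis unfolding s(2) unfolding s_def .
  qed
  have "(\<lambda>n. LINT y|lborel. f (x + sqrt (1 / real (Suc n)) *\<^sub>R y) * heat 1 y) \<longlonglongrightarrow> (LINT y|lborel. f x * heat 1 y)"
  proof (rule integral_dominated_convergence[where w="\<lambda>y. B * heat 1 y"])
    show "integrable lborel (\<lambda>y. B * heat 1 y)"
      using heat_integral[of 1] by (auto simp: has_bochner_integral_iff)
    show "AE y in lborel. norm (f (x + sqrt (1 / real (Suc n)) *\<^sub>R y) * heat 1 y) \<le> B * heat 1 y" for n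
      using f(2) heat_bounds(1)[of 1] by (auto simp: abs_mult intro!: AE_I2 mult_right_mono)
    have "(\<lambda>n. sqrt (1 / real (Suc n))) \<longlonglongrightarrow> sqrt 0"
      using tendsto_real_sqrt[OF LIMSEQ_inverse_real_of_nat] by (simp only: inverse_eq_divide)
    then have "(\<lambda>n. x + sqrt (1 / real (Suc n)) *\<^sub>R y) \<longlonglongrightarrow> x + sqrt 0 *\<^sub>R y" for y
      by (intro tendsto_add tendsto_scaleR tendsto_const)
    moreover have "isCont f x" using f(1) by (simp add: continuous_on_eq_continuous_at)
    ultimately have "(\<lambda>n. f (x + sqrt (1 / real (Suc n)) *\<^sub>R y)) \<longlonglongrightarrow> f x" for y
      by (intro isCont_tendsto_compose[of x f]) auto
    then show "AE y in lborel. (\<lambda>n. f (x + sqrt (1 / real (Suc n)) *\<^sub>R y) * heat 1 y) \<longlonglongrightarrow> f x * heat 1 y"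
      by (intro AE_I2 tendsto_mult tendsto_const)
    show "(\<lambda>y. f (x + sqrt (1 / real (Suc n)) *\<^sub>R y) * heat 1 y) \<in> borel_measurable lborel" for n
      unfolding measurable_lborel2 by (intro borel_measurable_continuous_onI continuous_intros) simp
    show "(\<lambda>y. f x * heat 1 y) \<in> borel_measurable lborel"
      unfolding measurable_lborel2 by (intro borel_measurable_continuous_onI continuous_intros)
  qed
  moreover have "(LINT y|lborel. f x * heat 1 y) = f x"
    using heat_integral[of 1] by (simp add: has_bochner_integral_iff)
  ultimately show ?thesis by (simp only: eq)
qed

context closed_curve
begin

definition winding_radial :: "real \<Rightarrow> real \<Rightarrow> complex \<Rightarrow> real" where
  "winding_radial a b z =
    integral {0..2 * pi} (\<lambda>t. (heat a (z - u t) - heat b (z - u t)) * cross z (u' t))"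

lemma continuous_on_winding_radial: "continuous_on UNIV (winding_radial a b)"
  unfolding winding_radial_def
  by (rule continuous_on_real_integral) (auto intro!: continuous_intros simp: split_beta)

lemma deriv_Re_Im:
  "((\<lambda>t. Re (u t)) has_real_derivative Re (u' t)) (at t)"
  "((\<lambda>t. Im (u t)) has_real_derivative Im (u' t)) (at t)"
  using bounded_linear.has_vector_derivative[OF bounded_linear_Re deriv]
    bounded_linear.has_vector_derivative[OF bounded_linear_Im deriv]
  by (simp_all add: has_real_derivative_iff_has_vector_derivative)

lemma winding_has_radial_derivative:
  assumes a: "0 < a" "a \<le> b"
  shows "has_radial_derivative (winding a b) (winding_radial a b)"
  unfolding has_radial_derivative_def
proof (intro allI impI)
  fix z :: complex and r :: real assume r: "0 < r"
  let ?Q = "cbox (0, a) (2 * pi, b)"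
  define E where "E x t s = exp (- (norm (x *\<^sub>R z - u t))\<^sup>2 / s)" for x t s
  define K where "K x = (\<lambda>(t, s). E x t s *
    (cross z (u' t) - 2 / s * ((x *\<^sub>R z - u t) \<bullet> z) * cross (x *\<^sub>R z - u t) (u' t)) / (2 * pi * s\<^sup>2))" for x
  have "((\<lambda>x. integral ?Q (kern (x *\<^sub>R z))) has_real_derivative integral ?Q (K r)) (at r within UNIV)"
  proof (rule leibniz_rule_field_derivative)
    fix x :: real and p assume p: "p \<in> ?Q"
    obtain t s where ts: "p = (t, s)" "0 < s" using p a by (cases p) (auto simp: cbox_Pair_eq)
    show "((\<lambda>x. kern (x *\<^sub>R z) p) has_real_derivative K x p) (at x within UNIV)"
      unfolding kern_def K_def E_def ts(1) prod.case cross_def cmod_power2 inner_complex_def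
      using ts(2)
      by (auto intro!: derivative_eq_intros) (simp add: field_simps power2_eq_square)
  next
    show "kern (x *\<^sub>R z) integrable_on ?Q" for x
      by (intro integrable_continuous continuous_on_kern a)
    show "continuous_on (UNIV \<times> ?Q) (\<lambda>(x, p). K x p)"
      using a unfolding K_def E_def by (auto intro!: continuous_intros simp: split_beta cbox_Pair_eq)
  qed auto
  moreover have "integral ?Q (K r) = winding_radial a b (r *\<^sub>R z) / r"
  proof -
    define y where "y t = r *\<^sub>R z - u t" for t
    define A where "A = (\<lambda>(t, s). cross z (u' t) * ((2 - 2 * (norm (y t))\<^sup>2 / s) * E r t s / (2 * pi * s\<^sup>2)))"
    define B where "B t s = E r t s * (cross z (u' t) + 2 / s * (y t \<bullet> u' t) * cross (y t) z)" for t s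
    define B' where "B' = (\<lambda>(t, s). 1 / (2 * pi * s\<^sup>2) * B t s)"
    have cA: "continuous_on ?Q A" and cB: "continuous_on ?Q B'"
      using a unfolding A_def B'_def B_def E_def y_def
      by (auto intro!: continuous_intros simp: split_beta cbox_Pair_eq)
    have "integral ?Q (K r) = integral ?Q (\<lambda>p. A p - B' p)"
    proof (rule integral_cong)
      fix p assume "p \<in> ?Q"
      then obtain t s where ts: "p = (t, s)" "0 < s" using a by (cases p) (auto simp: cbox_Pair_eq)
      have id: "(y t \<bullet> z) * cross (y t) (u' t) = (norm (y t))\<^sup>2 * cross z (u' t) + (y t \<bullet> u' t) * cross (y t) z"
        unfolding cross_def inner_complex_def cmod_power2 by algebra
      have "K r p = E r t s / (2 * pi * s\<^sup>2) * (cross z (u' t) - 2 / s * ((y t \<bullet> z) * cross (y t) (u' t)))"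
        by (simp add: K_def ts y_def)
      also have "\<dots> = A p - B' p"
        unfolding id by (simp add: A_def B'_def B_def ts) (simp add: algebra_simps add_divide_distrib diff_divide_distrib)
      finally show "K r p = A p - B' p" .
    qed
    also have "\<dots> = integral ?Q A - integral ?Q B'"
      by (intro Henstock_Kurzweil_Integration.integral_diff integrable_continuous cA cB)
    also have "integral ?Q B' = 0"
    proof -
      have "integral {0..2 * pi} (\<lambda>t. B t s) = 0" for s
      proof -
        define F where "F t = E r t s * cross (y t) z" for t
        have "((\<lambda>t. B t s) has_integral F (2 * pi) - F 0) {0..2 * pi}"
        proof (rule fundamental_theorem_of_calculus)
          fix t assume "t \<in> {0..2 * pi}"
          have "(F has_real_derivative B t s) (at t)"
            unfolding F_def B_def E_def y_def cross_def cmod_power2 inner_complex_def divide_inverse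
            by (auto intro!: derivative_eq_intros deriv deriv_Re_Im) (simp add: algebra_simps)
          then show "(F has_vector_derivative B t s) (at t within {0..2 * pi})"
            by (simp add: has_real_derivative_iff_has_vector_derivative has_vector_derivative_at_within)
        qed simp
        moreover have "F (2 * pi) = F 0" by (simp add: F_def E_def y_def closed)
        ultimately show ?thesis by (simp add: integral_unique)
      qed
      then have "integral {a..b} (\<lambda>s. integral {0..2 * pi} (\<lambda>t. 1 / (2 * pi * s\<^sup>2) * B t s)) = 0"
        by (simp del: times_divide_eq_left)
      then show ?thesis
        using integral_Pair_iterated(2)[OF cB[unfolded B'_def]] by (simp add: B'_def)
    qed
    also have "integral ?Q A - 0 = integral {0..2 * pi} (\<lambda>t. cross z (u' t) * (heat a (y t) - heat b (y t)))"
    proof -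
      have h: "integral {a..b} (\<lambda>s. (2 - 2 * (norm (y t))\<^sup>2 / s) * E r t s / (2 * pi * s\<^sup>2)) = heat a (y t) - heat b (y t)" for t
      proof -
        have "((\<lambda>s. (2 - 2 * (norm (y t))\<^sup>2 / s) * E r t s / (2 * pi * s\<^sup>2)) has_integral (- heat b (y t)) - (- heat a (y t))) {a..b}"
        proof (rule fundamental_theorem_of_calculus[OF a(2)])
          fix s assume "s \<in> {a..b}"
          then have s: "0 < s" using a by simp
          have "((\<lambda>s. - heat s (y t)) has_real_derivative (2 - 2 * (norm (y t))\<^sup>2 / s) * E r t s / (2 * pi * s\<^sup>2)) (at s)"
            unfolding heat_def E_def y_def[symmetric] using s
            by (auto intro!: derivative_eq_intros) (simp add: field_simps power2_eq_square)
          then show "((\<lambda>s. - heat s (y t)) has_vector_derivative (2 - 2 * (norm (y t))\<^sup>2 / s) * E r t s / (2 * pi * s\<^sup>2)) (at s within {a..b})"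
            by (simp add: has_real_derivative_iff_has_vector_derivative has_vector_derivative_at_within)
        qed
        then show ?thesis by (simp add: integral_unique)
      qed
      have "integral ?Q A = integral {0..2 * pi} (\<lambda>t. integral {a..b} (\<lambda>s. cross z (u' t) * ((2 - 2 * (norm (y t))\<^sup>2 / s) * E r t s / (2 * pi * s\<^sup>2))))"
        unfolding A_def by (rule integral_Pair_iterated(1)[OF cA[unfolded A_def]])
      then show ?thesis unfolding integral_mult_right h by simp
    qed
    also have "\<dots> = winding_radial a b (r *\<^sub>R z) / r"
    proof -
      have "winding_radial a b (r *\<^sub>R z) = integral {0..2 * pi} (\<lambda>t. r * (cross z (u' t) * (heat a (y t) - heat b (y t))))"
        unfolding winding_radial_def cross_scaleR_left y_def by (simp add: mult_ac)
      then show ?thesis using r unfolding integral_mult_right by simp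
    qed
    finally show ?thesis .
  qed
  ultimately show "((\<lambda>s. winding a b (s *\<^sub>R z)) has_real_derivative winding_radial a b (r *\<^sub>R z) / r) (at r)"
    by (simp add: winding_def)
qed

end

section \<open>Removal of the regularisation\<close>

lemma flat_2_bounds: "0 \<le> flat 2 x" "flat 2 x \<le> 2"
proof -
  have "exp (- 1 / x) / x\<^sup>2 \<le> 2" if "0 < x"
  proof -
    have "(1 / x)\<^sup>2 / 2 \<le> exp (1 / x)"
      using exp_lower_Taylor_quadratic[of "1 / x"] that by (smt (verit) zero_le_divide_1_iff)
    then have "exp (- (1 / x)) * ((1 / x)\<^sup>2 / 2) \<le> exp (- (1 / x)) * exp (1 / x)"
      by (intro mult_left_mono) auto
    then show ?thesis by (simp add: mult_exp_exp power_divide)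
  qed
  then show "flat 2 x \<le> 2" by (simp add: flat_def)
qed (simp add: flat_def)

definition bump_radial :: "real \<Rightarrow> complex \<Rightarrow> real" where
  "bump_radial R z = exp 1 * (flat 2 (1 - (norm z)\<^sup>2 / R\<^sup>2) * (- 2 * (norm z)\<^sup>2 / R\<^sup>2))"

lemma bump_has_radial_derivative: "has_radial_derivative (bump R) (bump_radial R)"
  unfolding has_radial_derivative_def
proof (intro allI impI)
  fix z :: complex and r :: real assume r: "0 < r"
  have "((\<lambda>s. 1 - (s * norm z)\<^sup>2 * inverse (R\<^sup>2)) has_real_derivative - 2 * r * (norm z)\<^sup>2 * inverse (R\<^sup>2)) (at r)"
    by (auto intro!: derivative_eq_intros simp: power2_eq_square)
  from DERIV_cmult[OF DERIV_chain2[OF flat_deriv[of 0] this], of "exp 1"]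
  have "((\<lambda>s. exp 1 * flat 0 (1 - (s * norm z)\<^sup>2 * inverse (R\<^sup>2))) has_real_derivative
    exp 1 * (flat 2 (1 - (r * norm z)\<^sup>2 * inverse (R\<^sup>2)) * (- 2 * r * (norm z)\<^sup>2 * inverse (R\<^sup>2)))) (at r)"
    by (simp add: numeral_2_eq_2)
  moreover have "exp 1 * (flat 2 (1 - (r * norm z)\<^sup>2 * inverse (R\<^sup>2)) * (- 2 * r * (norm z)\<^sup>2 * inverse (R\<^sup>2))) = bump_radial R (r *\<^sub>R z) / r"
    using r by (simp add: bump_radial_def divide_inverse power_mult_distrib power2_eq_square)
  ultimately show "((\<lambda>s. bump R (s *\<^sub>R z)) has_real_derivative bump_radial R (r *\<^sub>R z) / r) (at r)"
    by (simp add: bump_def divide_inverse power_mult_distrib)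
qed

lemma continuous_on_bump: "continuous_on UNIV (bump R)"
  using C_k_bump[of 0 R] by simp

lemma continuous_on_bump_radial: "continuous_on UNIV (bump_radial R)"
  unfolding bump_radial_def divide_inverse
  by (intro continuous_intros continuous_on_compose2[OF continuous_on_flat]) auto

lemma bump_radial_eq_0:
  assumes "0 < R" "R \<le> norm z"
  shows "bump_radial R z = 0"
proof -
  have "R\<^sup>2 \<le> (norm z)\<^sup>2" using assms by (simp add: power_mono)
  then have "1 \<le> (norm z)\<^sup>2 / R\<^sup>2" using assms by (simp add: le_divide_eq)
  then show ?thesis by (simp add: bump_radial_def flat_def)
qed

lemma abs_bump_radial_le: "\<bar>bump_radial R z\<bar> \<le> 4 * exp 1 * (norm z)\<^sup>2 / R\<^sup>2"
proof -
  have "\<bar>bump_radial R z\<bar> = exp 1 * (flat 2 (1 - (norm z)\<^sup>2 / R\<^sup>2) * (2 * (norm z)\<^sup>2 / R\<^sup>2))"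
    using flat_2_bounds(1)[of "1 - (norm z)\<^sup>2 / R\<^sup>2"] by (simp add: bump_radial_def abs_mult)
  also have "\<dots> \<le> exp 1 * (2 * (2 * (norm z)\<^sup>2 / R\<^sup>2))"
    by (intro mult_left_mono mult_right_mono flat_2_bounds) auto
  finally show ?thesis by (simp add: mult_ac)
qed

lemma abs_bump_radial_le_const:
  assumes "0 < R"
  shows "\<bar>bump_radial R z\<bar> \<le> 4 * exp 1"
proof (cases "R \<le> norm z")
  case False
  then have "(norm z)\<^sup>2 / R\<^sup>2 \<le> 1" using assms by (simp add: power_mono)
  then have "4 * exp 1 * ((norm z)\<^sup>2 / R\<^sup>2) \<le> 4 * exp 1 * 1" by (intro mult_left_mono) auto
  then show ?thesis using abs_bump_radial_le[of R z] by simp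
qed (use assms in \<open>simp add: bump_radial_eq_0\<close>)

lemma integrable_lborel_translate:
  fixes f :: "complex \<Rightarrow> real"
  assumes "integrable lborel f"
  shows "integrable lborel (\<lambda>z. f (a + z))"
proof -
  have "integrable (distr lborel borel ((+) a)) f" using assms by (simp add: lborel_distr_plus)
  then show ?thesis using assms by (subst (asm) integrable_distr_eq) auto
qed

lemma heat_integral_translate:
  assumes "0 < s"
  shows "integrable lborel (\<lambda>z. heat s (z - x))" "(LINT z|lborel. heat s (z - x)) = 1"
  using integrable_lborel_translate[of "heat s" "- x"] lborel_translate[of "heat s" "- x"] heat_integral[OF assms]
  by (auto simp: has_bochner_integral_iff)

context closed_curve
begin

lemma integral_winding_radial_tendsto:
  assumes h: "continuous_on UNIV h" and R: "0 < R" and supp: "\<And>z. R \<le> norm z \<Longrightarrow> h z = 0"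
  shows "(\<lambda>n. LINT z|lborel. h z * winding_radial (1 / real (Suc n)) (real (Suc n)) z)
    \<longlonglongrightarrow> integral {0..2 * pi} (\<lambda>t. h (u t) * cross (u t) (u' t))"
proof -
  note [continuous_intros] = continuous_on_compose2[OF h]
  define f where "f t z = h z * cross z (u' t)" for t z
  have cf: "continuous_on UNIV (f t)" for t unfolding f_def by (intro continuous_intros) auto
  have "compact (h ` cball 0 R)" by (intro compact_continuous_image continuous_intros compact_cball) auto
  then obtain M where M: "\<And>z. z \<in> cball 0 R \<Longrightarrow> norm (h z) \<le> M"
    using bounded_iff compact_imp_bounded by (metis imageI)
  have M0: "0 \<le> M" using M[of 0] R by (metis centre_in_cball less_imp_le norm_ge_zero order_trans)
  define B where "B = M * (R * c)"
  have B0: "0 \<le> B" using M0 R c_nonneg by (simp add: B_def)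
  have fB: "\<bar>f t z\<bar> \<le> B" for t z
  proof (cases "R \<le> norm z")
    case False
    have "\<bar>cross z (u' t)\<bar> \<le> R * c"
      by (rule order_trans[OF abs_cross_le mult_mono]) (use False speed R in auto)
    then show ?thesis
      using M[of z] False M0 unfolding f_def B_def abs_mult by (intro mult_mono) auto
  qed (use B0 supp in \<open>simp add: f_def\<close>)
  obtain a where a: "cball (0::complex) R \<subseteq> cbox (-a) a"
    using bounded_subset_cbox_symmetric[OF bounded_cball] by blast
  have h0: "h z = 0" if "z \<notin> cbox (-a) a" for z
    using supp[of z] a that by (cases "R \<le> norm z") (auto simp: subset_eq)
  define P where "P s t = (LINT z|lborel. f t z * heat s (z - u t))" for s t
  have P_eq: "P s t = integral (cbox (-a) a) (\<lambda>z. f t z * heat s (z - u t))"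
    and P_int: "integrable lborel (\<lambda>z. f t z * heat s (z - u t))" for s t
    unfolding P_def using h0
    by (auto intro!: lborel_integral_eq_integral_cbox[of _ "-a" a] continuous_intros simp: f_def)
  have cP: "continuous_on A (P s)" for s A
    unfolding P_eq[abs_def]
    by (rule integral_continuous_on_param) (auto simp: split_beta f_def intro!: continuous_intros)
  have swap: "(LINT z|lborel. h z * winding_radial s s' z) = integral {0..2 * pi} (\<lambda>t. P s t - P s' t)" for s s'
  proof -
    have "(LINT z|lborel. h z * winding_radial s s' z) = integral (cbox (-a) a) (\<lambda>z. h z * winding_radial s s' z)"
      using h0 by (intro lborel_integral_eq_integral_cbox) (auto intro!: continuous_intros continuous_on_winding_radial)
    also have "\<dots> = integral (cbox (-a) a) (\<lambda>z. integral {0..2 * pi} (\<lambda>t. f t z * heat s (z - u t) - f t z * heat s' (z - u t)))"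
      unfolding winding_radial_def integral_mult_right[symmetric] f_def by (simp add: algebra_simps)
    also have "\<dots> = integral {0..2 * pi} (\<lambda>t. integral (cbox (-a) a) (\<lambda>z. f t z * heat s (z - u t) - f t z * heat s' (z - u t)))"
    proof -
      have "continuous_on (cbox (-a, 0) (a, 2 * pi)) (\<lambda>(z, t). f t z * heat s (z - u t) - f t z * heat s' (z - u t))"
        unfolding f_def by (auto simp: split_beta intro!: continuous_intros)
      from integral_swap_continuous[OF this] show ?thesis by simp
    qed
    also have "\<dots> = integral {0..2 * pi} (\<lambda>t. P s t - P s' t)"
      unfolding P_eq
      by (intro integral_cong Henstock_Kurzweil_Integration.integral_diff integrable_continuous)
        (auto simp: f_def intro!: continuous_intros)
    finally show ?thesis .
  qed
  have Ple: "\<bar>P s t\<bar> \<le> B" if s: "0 < s" for s t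
  proof -
    have "\<bar>P s t\<bar> \<le> (LINT z|lborel. \<bar>f t z * heat s (z - u t)\<bar>)"
      unfolding P_def by (rule integral_abs_bound)
    also have "\<dots> \<le> (LINT z|lborel. B * heat s (z - u t))"
    proof (intro integral_mono integrable_abs P_int integrable_mult_right heat_integral_translate(1) s)
      show "\<bar>f t z * heat s (z - u t)\<bar> \<le> B * heat s (z - u t)" for z
        using heat_bounds(1)[OF s] fB by (auto simp: abs_mult intro!: mult_right_mono)
    qed
    finally show ?thesis using heat_integral_translate[OF s] by simp
  qed
  have Pinf: "(\<lambda>n. P (real (Suc n)) t) \<longlonglongrightarrow> 0" for t
  proof (rule Lim_null_comparison)
    have fi: "integrable lborel (f t)"
      using h0 by (intro lborel_integral_eq_integral_cbox(2)[of _ "-a" a] cf) (auto simp: f_def)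
    have "\<bar>P s t\<bar> \<le> (LINT z|lborel. \<bar>f t z\<bar>) / pi * inverse s" if s: "0 < s" for s
    proof -
      have "\<bar>P s t\<bar> \<le> (LINT z|lborel. \<bar>f t z * heat s (z - u t)\<bar>)"
        unfolding P_def by (rule integral_abs_bound)
      also have "\<dots> \<le> (LINT z|lborel. \<bar>f t z\<bar> * (1 / (pi * s)))"
      proof (intro integral_mono integrable_abs integrable_mult_left P_int fi)
        show "\<bar>f t z * heat s (z - u t)\<bar> \<le> \<bar>f t z\<bar> * (1 / (pi * s))" for z
          unfolding abs_mult using heat_bounds[OF s, of "z - u t"] by (intro mult_left_mono) auto
      qed
      also have "\<dots> = (LINT z|lborel. \<bar>f t z\<bar>) / pi * inverse s" by (simp add: divide_inverse)
      finally show ?thesis .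
    qed
    then show "\<forall>\<^sub>F n in sequentially. norm (P (real (Suc n)) t) \<le> (LINT z|lborel. \<bar>f t z\<bar>) / pi * inverse (real (Suc n))"
      by (intro always_eventually) simp
    show "(\<lambda>n. (LINT z|lborel. \<bar>f t z\<bar>) / pi * inverse (real (Suc n))) \<longlonglongrightarrow> 0"
      using tendsto_mult[OF tendsto_const LIMSEQ_inverse_real_of_nat, of "(LINT z|lborel. \<bar>f t z\<bar>) / pi"] by simp
  qed
  have P0: "(\<lambda>n. P (1 / real (Suc n)) t) \<longlonglongrightarrow> f t (u t)" for t
    unfolding P_def by (rule heat_approximate_identity[OF cf fB])
  have "(\<lambda>n. integral {0..2 * pi} (\<lambda>t. P (1 / real (Suc n)) t - P (real (Suc n)) t)) \<longlonglongrightarrow> integral {0..2 * pi} (\<lambda>t. f t (u t))"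
  proof (rule dominated_convergence(2))
    show "(\<lambda>t. P (1 / real (Suc n)) t - P (real (Suc n)) t) integrable_on {0..2 * pi}" for n
      by (intro integrable_continuous_real continuous_on_diff cP)
    show "(\<lambda>t. 2 * B) integrable_on {0..2 * pi}" by (rule integrable_const_ivl)
    show "norm (P (1 / real (Suc n)) t - P (real (Suc n)) t) \<le> 2 * B" for n t
      using Ple[of "1 / real (Suc n)" t] Ple[of "real (Suc n)" t] by simp
    show "(\<lambda>n. P (1 / real (Suc n)) t - P (real (Suc n)) t) \<longlonglongrightarrow> f t (u t)" for t
      using tendsto_diff[OF P0 Pinf] by simp
  qed
  then show ?thesis by (simp only: swap f_def)
qed

lemma abs_integral_bump_cross_le:
  assumes H: "continuous_on UNIV H" "square_integrable H" and C: "0 \<le> C"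
    and dl: "\<And>\<phi>. test_function \<phi> \<Longrightarrow> \<bar>dl H \<phi>\<bar> \<le> C * L2_norm \<phi>"
    and R: "0 < R"
  shows "\<bar>integral {0..2 * pi} (\<lambda>t. H (u t) * bump R (u t) * cross (u t) (u' t))\<bar>
    \<le> (C + L2_norm (\<lambda>z. H z * bump_radial R z)) * (sqrt pi * c)"
proof -
  note [continuous_intros] = continuous_on_compose2[OF H(1)] continuous_on_compose2[OF continuous_on_bump]
    continuous_on_compose2[OF continuous_on_bump_radial]
  have sHb: "square_integrable (\<lambda>z. H z * bump_radial R z)"
    using R by (intro square_integrable_compact_support[of _ R]) (auto intro!: continuous_intros simp: bump_radial_eq_0)
  have le: "\<bar>LINT z|lborel. (H z * bump R z) * winding_radial a b z\<bar>
      \<le> (C + L2_norm (\<lambda>z. H z * bump_radial R z)) * (sqrt pi * c)" if a: "0 < a" "a \<le> b" for a b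
  proof -
    note [continuous_intros] = continuous_on_compose2[OF continuous_on_winding[OF a(1)]]
      continuous_on_compose2[OF continuous_on_winding_radial]
    let ?w = "winding a b" and ?w' = "winding_radial a b"
    note sw = winding_square(1)[OF a]
    have sg: "square_integrable (\<lambda>z. ?w z * bump R z)"
      using R by (intro square_integrable_compact_support[of _ R]) (auto intro!: continuous_intros simp: bump_eq_0)
    have "L2_norm (\<lambda>z. ?w z * bump R z) \<le> L2_norm ?w"
      unfolding L2_norm_def
    proof (intro real_sqrt_le_mono integral_mono)
      show "integrable lborel (\<lambda>z. (?w z * bump R z)\<^sup>2)" "integrable lborel (\<lambda>z. (?w z)\<^sup>2)"
        using sw sg by (simp_all add: square_integrable_def)
      show "(?w z * bump R z)\<^sup>2 \<le> (?w z)\<^sup>2" for z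
        using bump_bounds[of R z] by (simp add: power_mult_distrib mult_left_le power_le_one)
    qed
    then have n: "L2_norm (\<lambda>z. ?w z * bump R z) \<le> sqrt pi * c"
      using L2_norm_winding_le[OF a] by simp
    have "\<bar>LINT z|lborel. H z * (?w' z * bump R z + ?w z * bump_radial R z)\<bar> \<le> C * L2_norm (\<lambda>z. ?w z * bump R z)"
      by (rule abs_integral_radial_derivative_le[OF H C dl, where R=R])
        (use R in \<open>auto intro!: continuous_intros has_radial_derivative_mult winding_has_radial_derivative a
          bump_has_radial_derivative simp: bump_eq_0 bump_radial_eq_0\<close>)
    also have "\<dots> \<le> C * (sqrt pi * c)" by (intro mult_left_mono n C)
    also have "(LINT z|lborel. H z * (?w' z * bump R z + ?w z * bump_radial R z))
      = (LINT z|lborel. (H z * bump R z) * ?w' z + (H z * bump_radial R z) * ?w z)"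
      by (simp add: algebra_simps)
    also have "\<dots> = (LINT z|lborel. (H z * bump R z) * ?w' z) + (LINT z|lborel. (H z * bump_radial R z) * ?w z)"
    proof (rule Bochner_Integration.integral_add)
      have "square_integrable (\<lambda>z. bump R z * ?w' z)"
        using R by (intro square_integrable_compact_support[of _ R]) (auto intro!: continuous_intros simp: bump_eq_0)
      from square_integrable_mult[OF H(2) this]
      show "integrable lborel (\<lambda>z. (H z * bump R z) * ?w' z)" by (simp add: mult.assoc)
      show "integrable lborel (\<lambda>z. (H z * bump_radial R z) * ?w z)"
        by (rule square_integrable_mult[OF sHb sw])
    qed
    finally have "\<bar>(LINT z|lborel. (H z * bump R z) * ?w' z) + (LINT z|lborel. (H z * bump_radial R z) * ?w z)\<bar> \<le> C * (sqrt pi * c)" .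
    moreover have "\<bar>LINT z|lborel. (H z * bump_radial R z) * ?w z\<bar> \<le> L2_norm (\<lambda>z. H z * bump_radial R z) * (sqrt pi * c)"
      using Cauchy_Schwarz_L2[OF sHb sw] mult_left_mono[OF L2_norm_winding_le[OF a], of "L2_norm (\<lambda>z. H z * bump_radial R z)"]
      by simp
    ultimately show ?thesis by (simp add: distrib_right)
  qed
  have "(\<lambda>n. LINT z|lborel. (H z * bump R z) * winding_radial (1 / real (Suc n)) (real (Suc n)) z)
    \<longlonglongrightarrow> integral {0..2 * pi} (\<lambda>t. H (u t) * bump R (u t) * cross (u t) (u' t))"
    using R by (intro integral_winding_radial_tendsto) (auto intro!: continuous_intros simp: bump_eq_0)
  then have "(\<lambda>n. \<bar>LINT z|lborel. (H z * bump R z) * winding_radial (1 / real (Suc n)) (real (Suc n)) z\<bar>)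
    \<longlonglongrightarrow> \<bar>integral {0..2 * pi} (\<lambda>t. H (u t) * bump R (u t) * cross (u t) (u' t))\<bar>"
    by (rule tendsto_rabs)
  moreover have "1 / real (Suc n) \<le> real (Suc n)" for n
    by (rule order_trans[of _ 1]) auto
  ultimately show ?thesis
    by (intro LIMSEQ_le_const2) (auto intro!: exI[of _ 0] le)
qed

lemma abs_integral_cross_le:
  assumes H: "continuous_on UNIV H" "square_integrable H" and C: "0 \<le> C"
    and dl: "\<And>\<phi>. test_function \<phi> \<Longrightarrow> \<bar>dl H \<phi>\<bar> \<le> C * L2_norm \<phi>"
  shows "\<bar>integral {0..2 * pi} (\<lambda>t. H (u t) * cross (u t) (u' t))\<bar> \<le> C * (sqrt pi * c)"
proof -
  note [continuous_intros] = continuous_on_compose2[OF H(1)] continuous_on_compose2[OF continuous_on_bump]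
    continuous_on_compose2[OF continuous_on_bump_radial]
  have mH [measurable]: "H \<in> borel_measurable borel" and iH: "integrable lborel (\<lambda>z. (H z)\<^sup>2)"
    using H(2) by (simp_all add: square_integrable_def)
  have mb [measurable]: "bump_radial R \<in> borel_measurable borel" for R
    by (rule borel_measurable_continuous_onI[OF continuous_on_bump_radial])
  have "(\<lambda>n. LINT z|lborel. (H z * bump_radial (real (Suc n)) z)\<^sup>2) \<longlonglongrightarrow> (LINT z|(lborel::complex measure). 0)"
  proof (rule integral_dominated_convergence[where w="\<lambda>z. (4 * exp 1)\<^sup>2 * (H z)\<^sup>2"])
    show "AE z in lborel. norm ((H z * bump_radial (real (Suc n)) z)\<^sup>2) \<le> (4 * exp 1)\<^sup>2 * (H z)\<^sup>2" for n
    proof (rule AE_I2)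
      fix z
      have "\<bar>bump_radial (real (Suc n)) z\<bar>\<^sup>2 \<le> (4 * exp 1)\<^sup>2"
        by (intro power_mono abs_bump_radial_le_const) auto
      then have "(bump_radial (real (Suc n)) z)\<^sup>2 * (H z)\<^sup>2 \<le> (4 * exp 1)\<^sup>2 * (H z)\<^sup>2"
        by (intro mult_right_mono) auto
      then show "norm ((H z * bump_radial (real (Suc n)) z)\<^sup>2) \<le> (4 * exp 1)\<^sup>2 * (H z)\<^sup>2"
        by (simp add: power_mult_distrib mult.commute)
    qed
    have "(\<lambda>n. bump_radial (real (Suc n)) z) \<longlonglongrightarrow> 0" for z
    proof (rule Lim_null_comparison)
      show "\<forall>\<^sub>F n in sequentially. norm (bump_radial (real (Suc n)) z) \<le> 4 * exp 1 * (norm z)\<^sup>2 * (inverse (real (Suc n)))\<^sup>2"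
        using abs_bump_radial_le[of _ z] by (intro always_eventually) (simp add: divide_inverse power_inverse)
      have "(\<lambda>n. 4 * exp 1 * (norm z)\<^sup>2 * (inverse (real (Suc n)))\<^sup>2) \<longlonglongrightarrow> 4 * exp 1 * (norm z)\<^sup>2 * 0\<^sup>2"
        by (intro tendsto_mult tendsto_const tendsto_power LIMSEQ_inverse_real_of_nat)
      then show "(\<lambda>n. 4 * exp 1 * (norm z)\<^sup>2 * (inverse (real (Suc n)))\<^sup>2) \<longlonglongrightarrow> 0" by simp
    qed
    then have "(\<lambda>n. (H z * bump_radial (real (Suc n)) z)\<^sup>2) \<longlonglongrightarrow> (H z * 0)\<^sup>2" for z
      by (intro tendsto_power tendsto_mult tendsto_const)
    then show "AE z in lborel. (\<lambda>n. (H z * bump_radial (real (Suc n)) z)\<^sup>2) \<longlonglongrightarrow> 0" by simp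
  qed (use iH in auto)
  then have "(\<lambda>n. L2_norm (\<lambda>z. H z * bump_radial (real (Suc n)) z)) \<longlonglongrightarrow> sqrt 0"
    unfolding L2_norm_def by (intro tendsto_real_sqrt) simp
  then have "(\<lambda>n. (C + L2_norm (\<lambda>z. H z * bump_radial (real (Suc n)) z)) * (sqrt pi * c)) \<longlonglongrightarrow> (C + sqrt 0) * (sqrt pi * c)"
    by (intro tendsto_mult tendsto_add tendsto_const)
  then have lim2: "(\<lambda>n. (C + L2_norm (\<lambda>z. H z * bump_radial (real (Suc n)) z)) * (sqrt pi * c)) \<longlonglongrightarrow> C * (sqrt pi * c)"
    by simp
  have "(\<lambda>n. integral {0..2 * pi} (\<lambda>t. H (u t) * bump (real (Suc n)) (u t) * cross (u t) (u' t)))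
    \<longlonglongrightarrow> integral {0..2 * pi} (\<lambda>t. H (u t) * cross (u t) (u' t))"
  proof (rule dominated_convergence(2))
    show "(\<lambda>t. H (u t) * bump (real (Suc n)) (u t) * cross (u t) (u' t)) integrable_on {0..2 * pi}" for n
      by (intro integrable_continuous_real continuous_intros) auto
    show "(\<lambda>t. \<bar>H (u t)\<bar> * \<bar>cross (u t) (u' t)\<bar>) integrable_on {0..2 * pi}"
      by (intro integrable_continuous_real continuous_intros) auto
    show "norm (H (u t) * bump (real (Suc n)) (u t) * cross (u t) (u' t)) \<le> \<bar>H (u t)\<bar> * \<bar>cross (u t) (u' t)\<bar>" for n t
      using bump_bounds[of "real (Suc n)" "u t"] by (simp add: abs_mult mult_right_mono mult_left_le)
    have "(\<lambda>n. H (u t) * bump (real (Suc n)) (u t) * cross (u t) (u' t)) \<longlonglongrightarrow> H (u t) * 1 * cross (u t) (u' t)" for t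
      by (intro tendsto_mult tendsto_const bump_tendsto_1)
    then show "(\<lambda>n. H (u t) * bump (real (Suc n)) (u t) * cross (u t) (u' t)) \<longlonglongrightarrow> H (u t) * cross (u t) (u' t)" for t
      by simp
  qed
  from tendsto_rabs[OF this] show ?thesis
    by (rule LIMSEQ_le[OF _ lim2]) (use abs_integral_bump_cross_le[OF H C dl] in auto)
qed

end

section \<open>Nonexistence of loops\<close>

lemma abs_dl_le:
  assumes "dl_in_L2 H" "test_function \<phi>"
  shows "\<bar>dl H \<phi>\<bar> \<le> L2_norm (dl_fun H) * L2_norm \<phi>"
proof -
  obtain T where T: "continuous_L2_functional T" "\<And>\<phi>. test_function \<phi> \<Longrightarrow> T \<phi> = dl H \<phi>"
    using assms(1) by (auto simp: dl_in_L2_def)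
  obtain g where "square_integrable g" "\<And>f. square_integrable f \<Longrightarrow> T f = (LINT z|lborel. g z * f z)"
    using Riesz_L2[OF T(1)] by blast
  then have "\<exists>g. square_integrable g \<and> (\<forall>\<phi>. test_function \<phi> \<longrightarrow> dl H \<phi> = (LINT z|lborel. g z * \<phi> z))"
    using T(2) test_function_square_integrable by (intro exI[of _ g]) metis
  from someI_ex[OF this] have "square_integrable (dl_fun H)" "dl H \<phi> = (LINT z|lborel. dl_fun H z * \<phi> z)"
    using assms(2) unfolding dl_fun_def by auto
  then show ?thesis
    using Cauchy_Schwarz_L2 test_function_square_integrable[OF assms(2)] by simp
qed

lemma H_loop_closed_curve:
  assumes "H_loop H u"
  obtains u' c where "closed_curve u u' c" "0 < c" "continuous_on UNIV H \<Longrightarrow>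
    integral {0..2 * pi} (\<lambda>t. H (u t) * cross (u t) (u' t)) = 2 * pi * c"
proof -
  define u' where "u' t = vector_derivative u (at t)" for t
  define u'' where "u'' t = vector_derivative u' (at t)" for t
  have per: "u (t + 2 * pi) = u t" for t
    using assms by (simp add: H_loop_def C2_circle_def)
  have du: "(u has_vector_derivative u' t) (at t)" for t
    using assms by (auto simp: H_loop_def C2_circle_def u'_def vector_derivative_works)
  have u'_eq: "u' = (\<lambda>s. vector_derivative u (at s))" by (auto simp: u'_def)
  have "u' differentiable (at t)" for t
    using assms by (simp add: H_loop_def C2_circle_def u'_eq)
  then have du': "(u' has_vector_derivative u'' t) (at t)" for t
    unfolding u''_def by (simp add: vector_derivative_works)
  have ode: "u'' t = (norm (u' t) * H (u t)) *\<^sub>R (\<i> * u' t)" for t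
    using assms by (simp add: H_loop_def u''_def u'_eq)
  have cu': "continuous_on UNIV u'"
    using du' by (intro continuous_at_imp_continuous_on) (auto intro: has_vector_derivative_continuous)
  have closed: "u (2 * pi) = u 0" using per[of 0] by simp
  have closed': "u' (2 * pi) = u' 0"
  proof -
    have "((\<lambda>t. u (t + 2 * pi)) has_vector_derivative 1 *\<^sub>R u' (0 + 2 * pi)) (at 0)"
    proof -
      have "((\<lambda>t. t + 2 * pi) has_vector_derivative 1) (at 0)"
        by (auto simp: has_real_derivative_iff_has_vector_derivative[symmetric] intro!: derivative_eq_intros)
      from vector_diff_chain_at[OF this du] show ?thesis by (simp add: o_def)
    qed
    then have "(u has_vector_derivative u' (2 * pi)) (at 0)" by (simp add: per)
    then show ?thesis using vector_derivative_unique_at du by blast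
  qed
  have "((\<lambda>t. u' t \<bullet> u' t) has_real_derivative 0) (at t)" for t
  proof -
    have "((\<lambda>t. u' t \<bullet> u' t) has_vector_derivative (u' t \<bullet> u'' t + u'' t \<bullet> u' t)) (at t)"
      using bounded_bilinear.has_vector_derivative[OF bounded_bilinear_inner du' du'] .
    moreover have "u' t \<bullet> u'' t + u'' t \<bullet> u' t = 0"
      unfolding ode by (simp add: inner_complex_def)
    ultimately show ?thesis by (simp add: has_real_derivative_iff_has_vector_derivative)
  qed
  then have "u' t \<bullet> u' t = u' 0 \<bullet> u' 0" for t
    using DERIV_isconst_all[of "\<lambda>t. u' t \<bullet> u' t" t 0] by simp
  then have speed_eq: "norm (u' t) = norm (u' 0)" for t by (simp add: norm_eq_sqrt_inner)
  define c where "c = norm (u' 0)"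
  have cc: "closed_curve u u' c"
    by unfold_locales (use du cu' closed eq_refl[OF speed_eq] in \<open>auto simp: c_def\<close>)
  have "c \<noteq> 0"
  proof
    assume "c = 0"
    then have "u' t = 0" for t using speed_eq[of t] by (simp add: c_def)
    then have d0: "(u has_derivative (\<lambda>_. 0)) (at t within UNIV)" for t
      using du[of t] by (simp add: has_vector_derivative_def)
    have "\<exists>k. \<forall>x\<in>UNIV. u x = k"
      by (rule has_derivative_zero_constant[OF convex_UNIV]) (rule d0)
    then have "u constant_on UNIV" by (auto simp: constant_on_def)
    then show False using assms by (simp add: H_loop_def)
  qed
  then have c0: "0 < c" by (simp add: c_def)
  have "integral {0..2 * pi} (\<lambda>t. H (u t) * cross (u t) (u' t)) = 2 * pi * c" if H: "continuous_on UNIV H"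
  proof -
    interpret closed_curve u u' c by (rule cc)
    note [continuous_intros] = continuous_on_compose2[OF H]
    have nc: "norm (u' t) = c" for t using speed_eq[of t] by (simp add: c_def)
    have "((\<lambda>t. c\<^sup>2 - c * (H (u t) * cross (u t) (u' t))) has_integral u (2 * pi) \<bullet> u' (2 * pi) - u 0 \<bullet> u' 0) {0..2 * pi}"
    proof (rule fundamental_theorem_of_calculus)
      fix t
      have "((\<lambda>t. u t \<bullet> u' t) has_vector_derivative (u t \<bullet> u'' t + u' t \<bullet> u' t)) (at t)"
        using bounded_bilinear.has_vector_derivative[OF bounded_bilinear_inner du du'] .
      moreover have "u t \<bullet> u'' t + u' t \<bullet> u' t = c\<^sup>2 - c * (H (u t) * cross (u t) (u' t))"
        unfolding ode power2_norm_eq_inner[symmetric] nc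
        by (simp add: inner_complex_def cross_def algebra_simps)
      ultimately show "((\<lambda>t. u t \<bullet> u' t) has_vector_derivative c\<^sup>2 - c * (H (u t) * cross (u t) (u' t))) (at t within {0..2 * pi})"
        by (simp add: has_vector_derivative_at_within)
    qed simp
    then have "integral {0..2 * pi} (\<lambda>t. c\<^sup>2 - c * (H (u t) * cross (u t) (u' t))) = 0"
      by (simp add: closed closed' integral_unique)
    moreover have "integral {0..2 * pi} (\<lambda>t. c\<^sup>2 - c * (H (u t) * cross (u t) (u' t)))
      = integral {0..2 * pi} (\<lambda>t. c\<^sup>2) - integral {0..2 * pi} (\<lambda>t. c * (H (u t) * cross (u t) (u' t)))"
      by (intro Henstock_Kurzweil_Integration.integral_diff integrable_continuous_real continuous_intros) auto
    ultimately have "c * integral {0..2 * pi} (\<lambda>t. H (u t) * cross (u t) (u' t)) = 2 * pi * c\<^sup>2"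
      unfolding integral_mult_right by simp
    then show ?thesis using c0 by (simp add: power2_eq_square)
  qed
  with cc c0 show ?thesis by (rule that)
qed

theorem theoremA2:
  fixes H :: "complex \<Rightarrow> real"
  assumes "continuous_on UNIV H"
    and "square_integrable H"
    and "N_H H < 1"
  shows "\<not> (\<exists>u. H_loop H u)"
proof
  assume "\<exists>u. H_loop H u"
  then obtain u u' c where c: "closed_curve u u' c" "0 < c"
    and eq: "integral {0..2 * pi} (\<lambda>t. H (u t) * cross (u t) (u' t)) = 2 * pi * c"
    using H_loop_closed_curve assms(1) by metis
  have dl: "dl_in_L2 H" using assms(3) by (auto simp: N_H_def split: if_splits)
  define C where "C = L2_norm (dl_fun H)"
  have "2 * pi * c \<le> C * (sqrt pi * c)"
    using closed_curve.abs_integral_cross_le[OF c(1) assms(1,2) _ abs_dl_le[OF dl]] c(2)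
    unfolding eq C_def by simp
  also have "2 * pi * c = 2 * (sqrt pi * sqrt pi) * c" by simp
  also have "\<dots> = (2 * sqrt pi) * (sqrt pi * c)" by (simp only: mult_ac)
  finally have "2 * sqrt pi \<le> C" by (rule mult_right_le_imp_le) (use c(2) in simp)
  then have "sqrt (4 * pi) \<le> C" by (simp add: real_sqrt_mult)
  moreover have "C < sqrt (4 * pi)"
    using assms(3) dl by (simp add: N_H_def C_def one_ereal_def field_simps)
  ultimately show False by simp
qed

end
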